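(* For every topological group $G$ the following conditions are equivalent: (1) $G$ is an NA group; (2) $\widehat{G}^{r}$ is an l-NA monoid; (3) $\widehat{G}^{l}$ is an r-NA monoid.
   Context: Topological groups are Hausdorff. A topological group is NA (non-archimedean) if it has a local base at the identity consisting of open subgroups. $\widehat G^r$ (resp. $\widehat G^l$) is the completion of $G$ with respect to its right uniformity $\mathcal U_R$ (resp. left uniformity $\mathcal U_L$). Here $\mathcal U_R$ has as a base the sets $\{(x,y): xy^{-1}\in U\}$ and $\mathcal U_L$ the sets $\{(x,y): x^{-1}y\in U\}$, with $U$ a neighborhood of the identity. It is well known that the multiplication of $G$ extends to a jointly continuous multiplication on $\widehat G^r$ and on $\widehat G^l$, making them topological monoids containing $G$ as a dense submonoid, opposite to each other. A topological monoid is a monoid with a Tychonoff topology for which multiplication is jointly continuous. A Stone space is a compact Hausdorff space with a base of clopen sets. A topological monoid $S$ is l-NA (left non-archimedean) if there are a Stone space $Y$, a jointly continuous left monoid action $S\times Y\to Y$ (with $e_S$ acting as the identity), and a topological embedding $\nu:S\hookrightarrow Y$ with dense image such that $\nu(st)=s\nu(t)$ for all $s,t\in S$. It is r-NA (right non-archimedean) if there are a Stone space $Y$, a jointly continuous right monoid action $Y\times S\to Y$, and a topological embedding $\nu:S\hookrightarrow Y$ with dense image such that $\nu(ts)=\nu(t)s$ for all $s,t\in S$. *)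

theory Defs
  imports "HOL-Analysis.Analysis" "HOL-Algebra.Group"
begin

section \<open>Topological groups, topological monoids, Stone spaces\<close>

definition topological_group :: "('a, 'b) monoid_scheme \<Rightarrow> 'a topology \<Rightarrow> bool" where
  "topological_group G T \<longleftrightarrow>
     group G \<and> topspace T = carrier G \<and> Hausdorff_space T \<and>
     continuous_map (prod_topology T T) T (\<lambda>(x, y). x \<otimes>\<^bsub>G\<^esub> y) \<and>
     continuous_map T T (\<lambda>x. inv\<^bsub>G\<^esub> x)"

definition NA_group :: "('a, 'b) monoid_scheme \<Rightarrow> 'a topology \<Rightarrow> bool" where
  "NA_group G T \<longleftrightarrow>
     topological_group G T \<and>
     (\<exists>\<B>. (\<forall>H\<in>\<B>. subgroup H G \<and> openin T H) \<and>
          (\<forall>W. openin T W \<and> \<one>\<^bsub>G\<^esub> \<in> W \<longrightarrow> (\<exists>H\<in>\<B>. H \<subseteq> W)))"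

definition topological_monoid :: "('a, 'b) monoid_scheme \<Rightarrow> 'a topology \<Rightarrow> bool" where
  "topological_monoid S T \<longleftrightarrow>
     monoid S \<and> topspace T = carrier S \<and>
     completely_regular_space T \<and> Hausdorff_space T \<and>
     continuous_map (prod_topology T T) T (\<lambda>(s, t). s \<otimes>\<^bsub>S\<^esub> t)"

definition Stone_space :: "'a topology \<Rightarrow> bool" where
  "Stone_space Y \<longleftrightarrow>
     compact_space Y \<and> Hausdorff_space Y \<and>
     (\<exists>\<B>. (\<forall>C\<in>\<B>. openin Y C \<and> closedin Y C) \<and>
          (\<forall>U y. openin Y U \<and> y \<in> U \<longrightarrow> (\<exists>C\<in>\<B>. y \<in> C \<and> C \<subseteq> U)))"


section \<open>Completion of a uniform structure\<close>

text \<open>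
  A uniformity on a set is represented by its filter of entourages, a filter on pairs
  concentrated on the square of that set. The library class \<open>uniform_space\<close> allows only one
  uniformity per type, whereas both the right and the left uniformity are needed here.

  The Hausdorff completion is Bourbaki's: its points are the minimal Cauchy filters. The order on
  the type \<open>'a filter\<close> is opposite to inclusion of filters as families of sets (\<open>F \<le> F'\<close> says that
  \<open>F\<close> is finer), so minimal filters are the maximal elements for \<open>\<le>\<close>.
\<close>

definition Cauchy_filter_on :: "('a \<times> 'a) filter \<Rightarrow> 'a filter \<Rightarrow> bool" where
  "Cauchy_filter_on \<U> F \<longleftrightarrow> F \<noteq> bot \<and> F \<times>\<^sub>F F \<le> \<U>"

definition completion_points :: "('a \<times> 'a) filter \<Rightarrow> 'a filter set" where
  "completion_points \<U> =
     {F. Cauchy_filter_on \<U> F \<and> (\<forall>F'. Cauchy_filter_on \<U> F' \<and> F \<le> F' \<longrightarrow> F' = F)}"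

definition completion_entourage ::
  "('a \<times> 'a) filter \<Rightarrow> ('a \<times> 'a) set \<Rightarrow> ('a filter \<times> 'a filter) set" where
  "completion_entourage \<U> E =
     {(F, H). F \<in> completion_points \<U> \<and> H \<in> completion_points \<U> \<and>
              (\<exists>M. (\<forall>\<^sub>F x in F. x \<in> M) \<and> (\<forall>\<^sub>F x in H. x \<in> M) \<and> M \<times> M \<subseteq> E)}"

definition completion_uniformity :: "('a \<times> 'a) filter \<Rightarrow> ('a filter \<times> 'a filter) filter" where
  "completion_uniformity \<U> =
     (INF E\<in>{E. \<forall>\<^sub>F p in \<U>. p \<in> E}. principal (completion_entourage \<U> E))"

definition uniform_topology :: "'a set \<Rightarrow> ('a \<times> 'a) filter \<Rightarrow> 'a topology" where
  "uniform_topology X \<U> =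
     topology (\<lambda>W. W \<subseteq> X \<and> (\<forall>x\<in>W. \<forall>\<^sub>F p in \<U>. fst p = x \<longrightarrow> snd p \<in> W))"

lemma openin_uniform_topology:
  "openin (uniform_topology X \<U>) W \<longleftrightarrow>
     W \<subseteq> X \<and> (\<forall>x\<in>W. \<forall>\<^sub>F p in \<U>. fst p = x \<longrightarrow> snd p \<in> W)"
proof -
  have "istopology (\<lambda>W. W \<subseteq> X \<and> (\<forall>x\<in>W. \<forall>\<^sub>F p in \<U>. fst p = x \<longrightarrow> snd p \<in> W))"
    unfolding istopology_def
  proof (intro conjI allI impI)
    fix S T
    assume S: "S \<subseteq> X \<and> (\<forall>x\<in>S. \<forall>\<^sub>F p in \<U>. fst p = x \<longrightarrow> snd p \<in> S)"
      and T: "T \<subseteq> X \<and> (\<forall>x\<in>T. \<forall>\<^sub>F p in \<U>. fst p = x \<longrightarrow> snd p \<in> T)"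
    then show "S \<inter> T \<subseteq> X" by blast
    show "\<forall>x\<in>S \<inter> T. \<forall>\<^sub>F p in \<U>. fst p = x \<longrightarrow> snd p \<in> S \<inter> T"
    proof
      fix x assume "x \<in> S \<inter> T"
      with S T have "\<forall>\<^sub>F p in \<U>. fst p = x \<longrightarrow> snd p \<in> S" "\<forall>\<^sub>F p in \<U>. fst p = x \<longrightarrow> snd p \<in> T"
        by auto
      then show "\<forall>\<^sub>F p in \<U>. fst p = x \<longrightarrow> snd p \<in> S \<inter> T"
        by eventually_elim auto
    qed
  next
    fix \<K>
    assume K: "\<forall>K\<in>\<K>. K \<subseteq> X \<and> (\<forall>x\<in>K. \<forall>\<^sub>F p in \<U>. fst p = x \<longrightarrow> snd p \<in> K)"
    then show "\<Union>\<K> \<subseteq> X" by blast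
    show "\<forall>x\<in>\<Union>\<K>. \<forall>\<^sub>F p in \<U>. fst p = x \<longrightarrow> snd p \<in> \<Union>\<K>"
    proof
      fix x assume "x \<in> \<Union>\<K>"
      then obtain K where "K \<in> \<K>" "x \<in> K" by blast
      with K have "\<forall>\<^sub>F p in \<U>. fst p = x \<longrightarrow> snd p \<in> K" by blast
      then show "\<forall>\<^sub>F p in \<U>. fst p = x \<longrightarrow> snd p \<in> \<Union>\<K>"
        by eventually_elim (use \<open>K \<in> \<K>\<close> in blast)
    qed
  qed
  then show ?thesis
    by (simp add: uniform_topology_def topology_inverse')
qed

definition completion_topology :: "('a \<times> 'a) filter \<Rightarrow> 'a filter topology" where
  "completion_topology \<U> = uniform_topology (completion_points \<U>) (completion_uniformity \<U>)"

lemma topspace_completion_topology: "topspace (completion_topology \<U>) = completion_points \<U>"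
proof -
  have "\<forall>\<^sub>F p in completion_uniformity \<U>. p \<in> completion_entourage \<U> UNIV"
    unfolding completion_uniformity_def
    by (rule eventually_INF1[where i = UNIV]) (auto simp: eventually_principal)
  then have "\<forall>\<^sub>F p in completion_uniformity \<U>. snd p \<in> completion_points \<U>"
    by eventually_elim (auto simp: completion_entourage_def)
  then have "openin (completion_topology \<U>) (completion_points \<U>)"
    unfolding completion_topology_def openin_uniform_topology
    by (auto elim: eventually_mono)
  moreover have "W \<subseteq> completion_points \<U>" if "openin (completion_topology \<U>) W" for W
    using that by (simp add: completion_topology_def openin_uniform_topology)
  ultimately show ?thesis
    by (metis openin_subset openin_topspace subset_antisym)
qed


section \<open>The monoids obtained by completing a topological group\<close>

definition right_uniformity ::
  "('a, 'b) monoid_scheme \<Rightarrow> 'a topology \<Rightarrow> ('a \<times> 'a) filter" where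
  "right_uniformity G T =
     (INF U\<in>{U. openin T U \<and> \<one>\<^bsub>G\<^esub> \<in> U}.
        principal {(x, y). x \<in> carrier G \<and> y \<in> carrier G \<and> x \<otimes>\<^bsub>G\<^esub> inv\<^bsub>G\<^esub> y \<in> U})"

definition left_uniformity ::
  "('a, 'b) monoid_scheme \<Rightarrow> 'a topology \<Rightarrow> ('a \<times> 'a) filter" where
  "left_uniformity G T =
     (INF U\<in>{U. openin T U \<and> \<one>\<^bsub>G\<^esub> \<in> U}.
        principal {(x, y). x \<in> carrier G \<and> y \<in> carrier G \<and> inv\<^bsub>G\<^esub> x \<otimes>\<^bsub>G\<^esub> y \<in> U})"

text \<open>
  Both uniformities induce the topology of \<open>G\<close>, so the canonical map from \<open>G\<close> to either completion
  sends \<open>x\<close> to its neighbourhood filter \<open>nhdsin T x\<close>. The multiplication of the completion is the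
  unique jointly continuous extension of the multiplication of \<open>G\<close>; \<open>extensional\<close> fixes its
  irrelevant values outside the carrier, as uniqueness requires in a logic of total functions.
\<close>

definition completion_mult ::
  "('a, 'b) monoid_scheme \<Rightarrow> 'a topology \<Rightarrow> ('a \<times> 'a) filter \<Rightarrow>
     'a filter \<times> 'a filter \<Rightarrow> 'a filter" where
  "completion_mult G T \<U> =
     (THE m. m \<in> extensional (completion_points \<U> \<times> completion_points \<U>) \<and>
             continuous_map (prod_topology (completion_topology \<U>) (completion_topology \<U>))
               (completion_topology \<U>) m \<and>
             (\<forall>x\<in>carrier G. \<forall>y\<in>carrier G.
                m (nhdsin T x, nhdsin T y) = nhdsin T (x \<otimes>\<^bsub>G\<^esub> y)))"

definition completion_monoid ::
  "('a, 'b) monoid_scheme \<Rightarrow> 'a topology \<Rightarrow> ('a \<times> 'a) filter \<Rightarrow> 'a filter monoid" where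
  "completion_monoid G T \<U> =
     \<lparr>carrier = completion_points \<U>,
      monoid.mult = (\<lambda>F H. completion_mult G T \<U> (F, H)),
      one = nhdsin T \<one>\<^bsub>G\<^esub>\<rparr>"


section \<open>Non-archimedean monoids\<close>

definition l_NA_witness ::
  "('s, 'b) monoid_scheme \<Rightarrow> 's topology \<Rightarrow>
     'y topology \<Rightarrow> ('s \<Rightarrow> 'y \<Rightarrow> 'y) \<Rightarrow> ('s \<Rightarrow> 'y) \<Rightarrow> bool" where
  "l_NA_witness S T Y act \<nu> \<longleftrightarrow>
     Stone_space Y \<and>
     continuous_map (prod_topology T Y) Y (\<lambda>(s, y). act s y) \<and>
     (\<forall>y\<in>topspace Y. act \<one>\<^bsub>S\<^esub> y = y) \<and>
     (\<forall>s\<in>carrier S. \<forall>t\<in>carrier S. \<forall>y\<in>topspace Y. act (s \<otimes>\<^bsub>S\<^esub> t) y = act s (act t y)) \<and>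
     embedding_map T Y \<nu> \<and>
     Y closure_of (\<nu> ` carrier S) = topspace Y \<and>
     (\<forall>s\<in>carrier S. \<forall>t\<in>carrier S. \<nu> (s \<otimes>\<^bsub>S\<^esub> t) = act s (\<nu> t))"

definition r_NA_witness ::
  "('s, 'b) monoid_scheme \<Rightarrow> 's topology \<Rightarrow>
     'y topology \<Rightarrow> ('y \<Rightarrow> 's \<Rightarrow> 'y) \<Rightarrow> ('s \<Rightarrow> 'y) \<Rightarrow> bool" where
  "r_NA_witness S T Y act \<nu> \<longleftrightarrow>
     Stone_space Y \<and>
     continuous_map (prod_topology Y T) Y (\<lambda>(y, s). act y s) \<and>
     (\<forall>y\<in>topspace Y. act y \<one>\<^bsub>S\<^esub> = y) \<and>
     (\<forall>s\<in>carrier S. \<forall>t\<in>carrier S. \<forall>y\<in>topspace Y. act y (s \<otimes>\<^bsub>S\<^esub> t) = act (act y s) t) \<and>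
     embedding_map T Y \<nu> \<and>
     Y closure_of (\<nu> ` carrier S) = topspace Y \<and>
     (\<forall>s\<in>carrier S. \<forall>t\<in>carrier S. \<nu> (t \<otimes>\<^bsub>S\<^esub> s) = act (\<nu> t) s)"

text \<open>
  HOL cannot quantify existentially over the type of the points of \<open>Y\<close>. A Hausdorff space with a
  dense subset indexed by \<open>'s\<close> injects into \<open>'s set set\<close>, so restricting the points of \<open>Y\<close> to
  that type loses no generality: see \<open>l_NA_monoidI\<close> and \<open>r_NA_monoidI\<close> below.
\<close>

definition l_NA_monoid :: "('s, 'b) monoid_scheme \<Rightarrow> 's topology \<Rightarrow> bool" where
  "l_NA_monoid S T \<longleftrightarrow>
     topological_monoid S T \<and>
     (\<exists>(Y :: 's set set topology) act \<nu>. l_NA_witness S T Y act \<nu>)"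

definition r_NA_monoid :: "('s, 'b) monoid_scheme \<Rightarrow> 's topology \<Rightarrow> bool" where
  "r_NA_monoid S T \<longleftrightarrow>
     topological_monoid S T \<and>
     (\<exists>(Y :: 's set set topology) act \<nu>. r_NA_witness S T Y act \<nu>)"

lemma dense_image_homeomorphic_copy:
  fixes Y :: "'y topology" and \<nu> :: "'s \<Rightarrow> 'y"
  assumes Y: "Hausdorff_space Y" and dense: "Y closure_of (\<nu> ` A) = topspace Y"
  obtains Y' :: "'s set set topology" and f g where "homeomorphic_maps Y Y' f g"
proof -
  define f where "f y = {B. B \<subseteq> A \<and> y \<in> Y closure_of (\<nu> ` B)}" for y
  have inj: "inj_on f (topspace Y)"
  proof (rule inj_onI, rule ccontr)
    fix y z assume y: "y \<in> topspace Y" and z: "z \<in> topspace Y" and eq: "f y = f z" and "y \<noteq> z"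
    then obtain U V where UV: "openin Y U" "openin Y V" "y \<in> U" "z \<in> V" "disjnt U V"
      using Y unfolding Hausdorff_space_def by metis
    define B where "B = {a \<in> A. \<nu> a \<in> U}"
    have "y \<in> Y closure_of (\<nu> ` B)"
      unfolding in_closure_of
    proof (intro conjI allI impI)
      fix W assume W: "y \<in> W \<and> openin Y W"
      then have "y \<in> W \<inter> U" "openin Y (W \<inter> U)" using UV by auto
      moreover have "y \<in> Y closure_of (\<nu> ` A)" using dense y by simp
      ultimately obtain x where "x \<in> \<nu> ` A" "x \<in> W \<inter> U" unfolding in_closure_of by blast
      then show "\<exists>x. x \<in> \<nu> ` B \<and> x \<in> W" unfolding B_def by blast
    qed (use y in simp)
    then have "B \<in> f y" by (auto simp: f_def B_def)
    then have "z \<in> Y closure_of (\<nu> ` B)" using eq by (auto simp: f_def)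
    then obtain x where "x \<in> \<nu> ` B" "x \<in> V" using UV unfolding in_closure_of by blast
    then show False using UV by (auto simp: B_def disjnt_iff)
  qed
  define g where "g = inv_into (topspace Y) f"
  define Y' where "Y' = pullback_topology (f ` topspace Y) g Y"
  have gf: "g (f y) = y" if "y \<in> topspace Y" for y
    using inj that by (simp add: g_def)
  have top: "topspace Y' = f ` topspace Y"
    using gf by (auto simp: Y'_def topspace_pullback_topology)
  have "continuous_map Y' Y g"
    unfolding Y'_def using continuous_map_pullback[of Y Y id "f ` topspace Y" g] by simp
  moreover have "continuous_map Y Y' f"
    unfolding Y'_def
  proof (rule continuous_map_pullback')
    show "continuous_map Y Y (g \<circ> f)"
      using gf by (intro continuous_map_eq[OF continuous_map_id]) auto
  qed auto
  ultimately have "homeomorphic_maps Y Y' f g"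
    unfolding homeomorphic_maps_def using gf top by auto
  then show ?thesis using that by blast
qed

lemma homeomorphic_maps_Stone_space:
  assumes fg: "homeomorphic_maps Y Y' f g" and Y: "Stone_space Y"
  shows "Stone_space Y'"
proof -
  have hom: "Y homeomorphic_space Y'" using fg homeomorphic_space_def by blast
  have f: "homeomorphic_map Y Y' f" using fg homeomorphic_map_maps by blast
  obtain \<B> where B: "\<forall>C\<in>\<B>. openin Y C \<and> closedin Y C"
      "\<forall>U y. openin Y U \<and> y \<in> U \<longrightarrow> (\<exists>C\<in>\<B>. y \<in> C \<and> C \<subseteq> U)"
    using Y unfolding Stone_space_def by blast
  have "\<forall>C\<in>(`) f ` \<B>. openin Y' C \<and> closedin Y' C"
    using B homeomorphic_imp_open_map[OF f] homeomorphic_imp_closed_map[OF f]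
    by (auto simp: open_map_def closed_map_def)
  moreover have "\<exists>C\<in>(`) f ` \<B>. z \<in> C \<and> C \<subseteq> U" if U: "openin Y' U" "z \<in> U" for U z
  proof -
    have z: "z \<in> topspace Y'" using U openin_subset by blast
    have g: "continuous_map Y' Y g" and fgz: "\<And>z. z \<in> topspace Y' \<Longrightarrow> f (g z) = z"
      and f': "continuous_map Y Y' f"
      using fg by (auto simp: homeomorphic_maps_def)
    let ?V = "{y \<in> topspace Y. f y \<in> U}"
    have "openin Y ?V" using f' U openin_continuous_map_preimage by blast
    moreover have "g z \<in> ?V" using z g fgz U by (auto simp: continuous_map_def)
    ultimately obtain C where "C \<in> \<B>" "g z \<in> C" "C \<subseteq> ?V" using B by meson
    then show ?thesis using fgz[OF z] by (intro bexI[of _ "f ` C"]) force+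
  qed
  ultimately show ?thesis
    using Y homeomorphic_compact_space[OF hom] homeomorphic_Hausdorff_space[OF hom]
    unfolding Stone_space_def by (intro conjI exI[of _ "(`) f ` \<B>"]) auto
qed

lemma embedding_map_image_subset:
  assumes "embedding_map T Y \<nu>" and "A \<subseteq> topspace T"
  shows "\<nu> ` A \<subseteq> topspace Y"
proof -
  have "\<nu> ` topspace T = topspace (subtopology Y (\<nu> ` topspace T))"
    using homeomorphic_imp_surjective_map assms(1) unfolding embedding_map_def by blast
  then show ?thesis using assms(2) by auto
qed

lemma embedding_dense_homeomorphic_maps:
  assumes fg: "homeomorphic_maps Y Y' f g"
    and \<nu>: "embedding_map T Y \<nu>" and A: "A \<subseteq> topspace T"
    and dense: "Y closure_of (\<nu> ` A) = topspace Y"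
  shows "embedding_map T Y' (f \<circ> \<nu>)" and "Y' closure_of ((f \<circ> \<nu>) ` A) = topspace Y'"
proof -
  have f: "homeomorphic_map Y Y' f" using fg homeomorphic_map_maps by blast
  then show "embedding_map T Y' (f \<circ> \<nu>)"
    using embedding_map_compose[OF \<nu>] surjective_embedding_map[of Y Y' f] by blast
  have "\<nu> ` A \<subseteq> topspace Y"
    using embedding_map_image_subset[OF \<nu> A] .
  then have "Y' closure_of (f ` (\<nu> ` A)) = f ` (Y closure_of (\<nu> ` A))"
    using f homeomorphic_map_closure_of by blast
  then show "Y' closure_of ((f \<circ> \<nu>) ` A) = topspace Y'"
    by (simp add: dense homeomorphic_imp_surjective_map[OF f] image_comp)
qed

lemma l_NA_monoidI:
  fixes Y :: "'y topology"
  assumes S: "topological_monoid S T" and w: "l_NA_witness S T Y act \<nu>"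
  shows "l_NA_monoid S T"
proof -
  have Y: "Stone_space Y"
    and cont: "continuous_map (prod_topology T Y) Y (\<lambda>(s, y). act s y)"
    and one: "\<And>y. y \<in> topspace Y \<Longrightarrow> act \<one>\<^bsub>S\<^esub> y = y"
    and assoc: "\<And>s t y. \<lbrakk>s \<in> carrier S; t \<in> carrier S; y \<in> topspace Y\<rbrakk> \<Longrightarrow>
                  act (s \<otimes>\<^bsub>S\<^esub> t) y = act s (act t y)"
    and emb: "embedding_map T Y \<nu>" and dense: "Y closure_of (\<nu> ` carrier S) = topspace Y"
    and equiv: "\<And>s t. \<lbrakk>s \<in> carrier S; t \<in> carrier S\<rbrakk> \<Longrightarrow> \<nu> (s \<otimes>\<^bsub>S\<^esub> t) = act s (\<nu> t)"
    using w unfolding l_NA_witness_def by blast+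
  have T: "topspace T = carrier S" using S by (simp add: topological_monoid_def)
  obtain Y' :: "'a set set topology" and f g where fg: "homeomorphic_maps Y Y' f g"
    using dense_image_homeomorphic_copy[OF _ dense] Y unfolding Stone_space_def by blast
  have f: "continuous_map Y Y' f" and g: "continuous_map Y' Y g"
    and gf: "\<And>y. y \<in> topspace Y \<Longrightarrow> g (f y) = y"
    and fgz: "\<And>z. z \<in> topspace Y' \<Longrightarrow> f (g z) = z"
    using fg by (auto simp: homeomorphic_maps_def)
  have gY: "g z \<in> topspace Y" if "z \<in> topspace Y'" for z
    using g that by (auto simp: continuous_map_def)
  have actY: "act s y \<in> topspace Y" if "s \<in> carrier S" "y \<in> topspace Y" for s y
    using funcset_mem[OF continuous_map_funspace[OF cont], of "(s, y)"] that T by simp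
  have \<nu>Y: "\<nu> t \<in> topspace Y" if "t \<in> carrier S" for t
    using embedding_map_image_subset[OF emb, of "{t}"] that T by simp
  define act' where "act' = (\<lambda>s z. f (act s (g z)))"
  have "continuous_map (prod_topology T Y') (prod_topology T Y) (\<lambda>(s, z). (s, g z))"
    using continuous_map_pairedI[OF continuous_map_fst continuous_map_compose[OF continuous_map_snd g]]
    by (simp add: case_prod_unfold)
  then have "continuous_map (prod_topology T Y') Y' (f \<circ> ((\<lambda>(s, y). act s y) \<circ> (\<lambda>(s, z). (s, g z))))"
    by (intro continuous_map_compose[OF _ f] continuous_map_compose[OF _ cont])
  then have "continuous_map (prod_topology T Y') Y' (\<lambda>(s, z). act' s z)"
    by (simp add: act'_def o_def case_prod_unfold)
  then have "l_NA_witness S T Y' act' (f \<circ> \<nu>)"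
    unfolding l_NA_witness_def
  proof (intro conjI ballI)
    show "Stone_space Y'" by (rule homeomorphic_maps_Stone_space[OF fg Y])
    show "embedding_map T Y' (f \<circ> \<nu>)" "Y' closure_of ((f \<circ> \<nu>) ` carrier S) = topspace Y'"
      using embedding_dense_homeomorphic_maps[OF fg emb _ dense] T by auto
  qed (simp_all add: act'_def one assoc equiv gf fgz gY actY \<nu>Y)
  then show ?thesis using S unfolding l_NA_monoid_def by blast
qed

lemma r_NA_monoidI:
  fixes Y :: "'y topology"
  assumes S: "topological_monoid S T" and w: "r_NA_witness S T Y act \<nu>"
  shows "r_NA_monoid S T"
proof -
  have Y: "Stone_space Y"
    and cont: "continuous_map (prod_topology Y T) Y (\<lambda>(y, s). act y s)"
    and one: "\<And>y. y \<in> topspace Y \<Longrightarrow> act y \<one>\<^bsub>S\<^esub> = y"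
    and assoc: "\<And>s t y. \<lbrakk>s \<in> carrier S; t \<in> carrier S; y \<in> topspace Y\<rbrakk> \<Longrightarrow>
                  act y (s \<otimes>\<^bsub>S\<^esub> t) = act (act y s) t"
    and emb: "embedding_map T Y \<nu>" and dense: "Y closure_of (\<nu> ` carrier S) = topspace Y"
    and equiv: "\<And>s t. \<lbrakk>s \<in> carrier S; t \<in> carrier S\<rbrakk> \<Longrightarrow> \<nu> (t \<otimes>\<^bsub>S\<^esub> s) = act (\<nu> t) s"
    using w unfolding r_NA_witness_def by blast+
  have T: "topspace T = carrier S" using S by (simp add: topological_monoid_def)
  obtain Y' :: "'a set set topology" and f g where fg: "homeomorphic_maps Y Y' f g"
    using dense_image_homeomorphic_copy[OF _ dense] Y unfolding Stone_space_def by blast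
  have f: "continuous_map Y Y' f" and g: "continuous_map Y' Y g"
    and gf: "\<And>y. y \<in> topspace Y \<Longrightarrow> g (f y) = y"
    and fgz: "\<And>z. z \<in> topspace Y' \<Longrightarrow> f (g z) = z"
    using fg by (auto simp: homeomorphic_maps_def)
  have gY: "g z \<in> topspace Y" if "z \<in> topspace Y'" for z
    using g that by (auto simp: continuous_map_def)
  have actY: "act y s \<in> topspace Y" if "s \<in> carrier S" "y \<in> topspace Y" for s y
    using funcset_mem[OF continuous_map_funspace[OF cont], of "(y, s)"] that T by simp
  have \<nu>Y: "\<nu> t \<in> topspace Y" if "t \<in> carrier S" for t
    using embedding_map_image_subset[OF emb, of "{t}"] that T by simp
  define act' where "act' = (\<lambda>z s. f (act (g z) s))"
  have "continuous_map (prod_topology Y' T) (prod_topology Y T) (\<lambda>(z, s). (g z, s))"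
    using continuous_map_pairedI[OF continuous_map_compose[OF continuous_map_fst g] continuous_map_snd]
    by (simp add: case_prod_unfold)
  then have "continuous_map (prod_topology Y' T) Y' (f \<circ> ((\<lambda>(y, s). act y s) \<circ> (\<lambda>(z, s). (g z, s))))"
    by (intro continuous_map_compose[OF _ f] continuous_map_compose[OF _ cont])
  then have "continuous_map (prod_topology Y' T) Y' (\<lambda>(z, s). act' z s)"
    by (simp add: act'_def o_def case_prod_unfold)
  then have "r_NA_witness S T Y' act' (f \<circ> \<nu>)"
    unfolding r_NA_witness_def
  proof (intro conjI ballI)
    show "Stone_space Y'" by (rule homeomorphic_maps_Stone_space[OF fg Y])
    show "embedding_map T Y' (f \<circ> \<nu>)" "Y' closure_of ((f \<circ> \<nu>) ` carrier S) = topspace Y'"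
      using embedding_dense_homeomorphic_maps[OF fg emb _ dense] T by auto
  qed (simp_all add: act'_def one assoc equiv gf fgz gY actY \<nu>Y)
  then show ?thesis using S unfolding r_NA_monoid_def by blast
qed

end

theory Submission
  imports Defs
begin

text \<open>
  Write \<open>F H\<close> for the filter generated by the products \<open>A B\<close> with \<open>A \<in> F\<close>, \<open>B \<in> H\<close>, and \<open>N\<close> for the
  neighbourhood filter of the identity. The minimal Cauchy filters of the right uniformity are the
  Cauchy filters \<open>F\<close> with \<open>N F = F\<close>, and the multiplication of the completion is \<open>(F, H) \<mapsto> F H\<close>.

  If \<open>G\<close> is non-archimedean, consider the sets \<open>A \<subseteq> G\<close> with \<open>H A = A\<close> for some open subgroup \<open>H\<close>.
  A point \<open>F\<close> of the completion acts on the Cantor cube indexed by these sets: \<open>(F y)(A)\<close> is the value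
  of \<open>y(g\<^sup>-\<^sup>1 A)\<close> for almost all \<open>g\<close> in \<open>F\<close>, which makes sense because \<open>g\<^sup>-\<^sup>1 A\<close> depends only on the coset
  \<open>H g\<close>. Sending \<open>F\<close> to the indicator of \<open>A \<in> F\<close> embeds the completion equivariantly, and the closure of
  the image is the required Stone space. Conversely, the stabilizers in \<open>G\<close> of the clopen subsets of a
  Stone space on which \<open>G\<close> acts continuously are open subgroups, and an embedded orbit makes them a
  local base. The left uniformity is the right uniformity of the opposite group.
\<close>

section \<open>The completion of a topological group for its right uniformity\<close>

definition filter_mult :: "('a, 'b) monoid_scheme \<Rightarrow> 'a filter \<Rightarrow> 'a filter \<Rightarrow> 'a filter" where
  "filter_mult G F H = filtermap (\<lambda>(x, y). x \<otimes>\<^bsub>G\<^esub> y) (F \<times>\<^sub>F H)"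

lemma eventually_filter_mult:
  "eventually P (filter_mult G F H) \<longleftrightarrow>
     (\<exists>Q R. eventually Q F \<and> eventually R H \<and> (\<forall>x y. Q x \<longrightarrow> R y \<longrightarrow> P (x \<otimes>\<^bsub>G\<^esub> y)))"
  by (simp add: filter_mult_def eventually_filtermap eventually_prod_filter)

lemma filter_mult_mono: "F \<le> F' \<Longrightarrow> H \<le> H' \<Longrightarrow> filter_mult G F H \<le> filter_mult G F' H'"
  unfolding filter_mult_def by (intro filtermap_mono prod_filter_mono)

lemma filter_mult_eq_bot: "filter_mult G F H = bot \<longleftrightarrow> F = bot \<or> H = bot"
  by (simp add: filter_mult_def filtermap_bot_iff prod_filter_eq_bot)

lemma eventually_filter_multI:
  "\<lbrakk>eventually Q F; eventually R H; \<And>x y. Q x \<Longrightarrow> R y \<Longrightarrow> P (x \<otimes>\<^bsub>G\<^esub> y)\<rbrakk> \<Longrightarrow>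
     eventually P (filter_mult G F H)"
  unfolding eventually_filter_mult by blast

text \<open>A locale, because the results are instantiated twice: for the group itself and for its
  opposite.\<close>

locale top_group =
  fixes G :: "('a, 'b) monoid_scheme" (structure) and T :: "'a topology"
  assumes top_group: "topological_group G T"

sublocale top_group \<subseteq> group G
  using top_group by (simp add: topological_group_def)

context top_group
begin

abbreviation nbhd1 :: "'a set \<Rightarrow> bool" where
  "nbhd1 U \<equiv> openin T U \<and> \<one> \<in> U"

abbreviation \<U> :: "('a \<times> 'a) filter" where
  "\<U> \<equiv> right_uniformity G T"

lemma topspace_eq [simp]: "topspace T = carrier G"
  using top_group by (simp add: topological_group_def)

lemma open_subset_carrier: "openin T U \<Longrightarrow> x \<in> U \<Longrightarrow> x \<in> carrier G"
  using openin_subset by fastforce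

section \<open>Translations and neighbourhoods of the identity\<close>

lemma continuous_map_group_mult:
  assumes "continuous_map X T f" "continuous_map X T g"
  shows "continuous_map X T (\<lambda>x. f x \<otimes> g x)"
proof -
  have "continuous_map (prod_topology T T) T (\<lambda>(x, y). x \<otimes> y)"
    using top_group by (simp add: topological_group_def)
  from continuous_map_compose[OF continuous_map_pairedI[OF assms] this]
  show ?thesis by (simp add: o_def)
qed

lemma continuous_map_group_inv:
  assumes "continuous_map X T f"
  shows "continuous_map X T (\<lambda>x. inv (f x))"
proof -
  have "continuous_map T T (\<lambda>x. inv x)"
    using top_group by (simp add: topological_group_def)
  from continuous_map_compose[OF assms this] show ?thesis by (simp add: o_def)
qed

lemma openin_left_preimage:
  assumes "g \<in> carrier G" "openin T U"
  shows "openin T {x \<in> carrier G. g \<otimes> x \<in> U}"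
  using openin_continuous_map_preimage[OF continuous_map_group_mult[of T "\<lambda>_. g" "\<lambda>x. x"] assms(2)]
    assms(1) by simp

lemma openin_right_preimage:
  assumes "g \<in> carrier G" "openin T U"
  shows "openin T {x \<in> carrier G. x \<otimes> g \<in> U}"
  using openin_continuous_map_preimage[OF continuous_map_group_mult[of T "\<lambda>x. x" "\<lambda>_. g"] assms(2)]
    assms(1) by simp

text \<open>Conjugated neighbourhoods let a fixed element be moved across a small factor:
  \<open>g z = (g z g^-1) g\<close>.\<close>

lemma openin_conj_preimage:
  assumes "g \<in> carrier G" "openin T U"
  shows "openin T {x \<in> carrier G. g \<otimes> x \<otimes> inv g \<in> U}"
  using openin_left_preimage[OF assms(1) openin_right_preimage[OF inv_closed[OF assms(1)] assms(2)]]
    assms(1) by (auto elim!: back_subst[of "openin T"])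

lemma continuous_at_one_pair:
  assumes "continuous_map (prod_topology T T) T (\<lambda>(x, y). f x y)" "f \<one> \<one> = \<one>" "nbhd1 U"
  obtains V where "nbhd1 V" "\<And>x y. x \<in> V \<Longrightarrow> y \<in> V \<Longrightarrow> f x y \<in> U"
proof -
  have "openin (prod_topology T T) {p \<in> carrier G \<times> carrier G. (\<lambda>(x, y). f x y) p \<in> U}"
    using openin_continuous_map_preimage[OF assms(1)] assms(3) by auto
  moreover have "(\<one>, \<one>) \<in> {p \<in> carrier G \<times> carrier G. (\<lambda>(x, y). f x y) p \<in> U}"
    using assms by simp
  ultimately obtain V W where "openin T V" "openin T W" "\<one> \<in> V" "\<one> \<in> W"
      "V \<times> W \<subseteq> {p \<in> carrier G \<times> carrier G. (\<lambda>(x, y). f x y) p \<in> U}"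
    unfolding openin_prod_topology_alt by meson
  then show ?thesis
    by (intro that[of "V \<inter> W"]) auto
qed

lemma nbhd1_mult:
  assumes "nbhd1 U"
  obtains V where "nbhd1 V" "\<And>x y. x \<in> V \<Longrightarrow> y \<in> V \<Longrightarrow> x \<otimes> y \<in> U"
  using continuous_at_one_pair[of "\<lambda>x y. x \<otimes> y"] assms
    continuous_map_group_mult[OF continuous_map_fst continuous_map_snd]
  by (auto simp: case_prod_unfold)

lemma nbhd1_div:
  assumes "nbhd1 U"
  obtains V where "nbhd1 V" "\<And>x y. x \<in> V \<Longrightarrow> y \<in> V \<Longrightarrow> x \<otimes> inv y \<in> U"
  using continuous_at_one_pair[of "\<lambda>x y. x \<otimes> inv y"] assms
    continuous_map_group_mult[OF continuous_map_fst continuous_map_group_inv[OF continuous_map_snd]]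
  by (auto simp: case_prod_unfold)

lemma eventually_nhdsin_one: "eventually P (nhdsin T \<one>) \<longleftrightarrow> (\<exists>U. nbhd1 U \<and> (\<forall>x\<in>U. P x))"
  by (auto simp: eventually_nhdsin)

section \<open>The right uniformity and its Cauchy filters\<close>

lemma eventually_right_uniformity:
  "eventually P \<U> \<longleftrightarrow>
     (\<exists>U. nbhd1 U \<and> (\<forall>x\<in>carrier G. \<forall>y\<in>carrier G. x \<otimes> inv y \<in> U \<longrightarrow> P (x, y)))"
proof -
  have "\<U> = (INF U\<in>Collect nbhd1.
      principal {(x, y). x \<in> carrier G \<and> y \<in> carrier G \<and> x \<otimes> inv y \<in> U})"
    by (simp add: right_uniformity_def)
  moreover have "Collect nbhd1 \<noteq> {}"
    using openin_topspace[of T] by auto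
  ultimately show ?thesis
    apply (simp only:)
    apply (subst eventually_INF_base)
      apply assumption
    subgoal for U V by (intro bexI[of _ "U \<inter> V"]) auto
    by (auto simp: eventually_principal)
qed

text \<open>Filters live on the whole type, while the group laws hold only on the carrier; the basic
  entourages, being subsets of its square, supply the membership.\<close>

lemma Cauchy_eventually_carrier:
  assumes "Cauchy_filter_on \<U> F"
  shows "\<forall>\<^sub>F x in F. x \<in> carrier G"
proof -
  have "eventually (\<lambda>p. fst p \<in> carrier G) \<U>"
    unfolding eventually_right_uniformity using openin_topspace[of T] by fastforce
  then have "eventually (\<lambda>p. fst p \<in> carrier G) (F \<times>\<^sub>F F)"
    using assms by (auto simp: Cauchy_filter_on_def le_filter_def)
  then obtain Q where Q: "eventually Q F" "\<forall>x y. Q x \<longrightarrow> Q y \<longrightarrow> x \<in> carrier G"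
    unfolding eventually_prod_same by auto
  then show ?thesis by (auto elim!: eventually_mono)
qed

lemma Cauchy_filter_small:
  assumes "Cauchy_filter_on \<U> F" "nbhd1 U"
  obtains M where "eventually M F"
    "\<And>x y. M x \<Longrightarrow> M y \<Longrightarrow> x \<in> carrier G \<and> y \<in> carrier G \<and> x \<otimes> inv y \<in> U"
proof -
  have "eventually (\<lambda>p. fst p \<otimes> inv (snd p) \<in> U) \<U>"
    unfolding eventually_right_uniformity using assms(2) by auto
  then have "eventually (\<lambda>p. fst p \<otimes> inv (snd p) \<in> U) (F \<times>\<^sub>F F)"
    using assms by (auto simp: Cauchy_filter_on_def le_filter_def)
  then obtain Q where Q: "eventually Q F" "\<And>x y. Q x \<longrightarrow> Q y \<longrightarrow> x \<otimes> inv y \<in> U"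
    unfolding eventually_prod_same by auto
  have "eventually (\<lambda>x. Q x \<and> x \<in> carrier G) F"
    using Q Cauchy_eventually_carrier[OF assms(1)] by (simp add: eventually_conj)
  then show ?thesis using Q by (intro that[of "\<lambda>x. Q x \<and> x \<in> carrier G"]) auto
qed

text \<open>Small sets can be taken to be translates \<open>U g\<close>: any point of a small member
  serves as \<open>g\<close>. Conversely, \<open>x\<close> and \<open>y\<close> in
  \<open>V g\<close> satisfy \<open>x y^-1 = (x g^-1) (y g^-1)^-1\<close>, which lies in
  \<open>U\<close> once \<open>V V^-1\<close> does.\<close>

lemma Cauchy_filter_iff:
  "Cauchy_filter_on \<U> F \<longleftrightarrow>
     F \<noteq> bot \<and> (\<forall>U. nbhd1 U \<longrightarrow>
       (\<exists>g\<in>carrier G. \<forall>\<^sub>F x in F. x \<in> carrier G \<and> x \<otimes> inv g \<in> U))" (is "?L \<longleftrightarrow> ?R")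
proof
  assume L: ?L
  then have nb: "F \<noteq> bot" by (simp add: Cauchy_filter_on_def)
  moreover have "\<exists>g\<in>carrier G. \<forall>\<^sub>F x in F. x \<in> carrier G \<and> x \<otimes> inv g \<in> U" if U: "nbhd1 U" for U
  proof -
    obtain M where M: "eventually M F"
        "\<And>x y. M x \<Longrightarrow> M y \<Longrightarrow> x \<in> carrier G \<and> y \<in> carrier G \<and> x \<otimes> inv y \<in> U"
      using Cauchy_filter_small[OF L U] by blast
    obtain g where "M g" using eventually_happens'[OF nb M(1)] by blast
    then show ?thesis using M by (intro bexI[of _ g]) (auto elim!: eventually_mono)
  qed
  ultimately show ?R by blast
next
  assume R: ?R
  have "F \<times>\<^sub>F F \<le> \<U>"
  proof (rule filter_leI)
    fix P assume "eventually P \<U>"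
    then obtain U where U: "nbhd1 U" "\<And>x y. \<lbrakk>x \<in> carrier G; y \<in> carrier G; x \<otimes> inv y \<in> U\<rbrakk> \<Longrightarrow> P (x, y)"
      unfolding eventually_right_uniformity by blast
    obtain V where V: "nbhd1 V" "\<And>x y. x \<in> V \<Longrightarrow> y \<in> V \<Longrightarrow> x \<otimes> inv y \<in> U"
      using nbhd1_div[OF U(1)] by blast
    obtain g where g: "g \<in> carrier G" "\<forall>\<^sub>F x in F. x \<in> carrier G \<and> x \<otimes> inv g \<in> V"
      using R V by blast
    show "eventually P (F \<times>\<^sub>F F)"
      unfolding eventually_prod_same
    proof (intro exI conjI allI impI)
      fix x y assume x: "x \<in> carrier G \<and> x \<otimes> inv g \<in> V" and y: "y \<in> carrier G \<and> y \<otimes> inv g \<in> V"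
      then have "(x \<otimes> inv g) \<otimes> inv (y \<otimes> inv g) \<in> U" using V by blast
      also have "(x \<otimes> inv g) \<otimes> inv (y \<otimes> inv g) = x \<otimes> inv y"
        using x y g by (simp add: inv_mult_group m_assoc flip: m_assoc[of "inv g" g])
      finally show "P (x, y)" using U x y by blast
    qed (use g in auto)
  qed
  then show ?L using R by (simp add: Cauchy_filter_on_def)
qed

text \<open>If \<open>x \<in> V g\<close> and \<open>y \<in> W h\<close> with
  \<open>g W g^-1 \<subseteq> V\<close>, then \<open>x y \<in> V V g h\<close>. Since
  \<open>W\<close> depends on \<open>g\<close>, the left factor is localized first.\<close>

lemma Cauchy_filter_mult:
  assumes F: "Cauchy_filter_on \<U> F" and H: "Cauchy_filter_on \<U> H"
  shows "Cauchy_filter_on \<U> (filter_mult G F H)"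
  unfolding Cauchy_filter_iff
proof (intro conjI allI impI)
  show "filter_mult G F H \<noteq> bot"
    using F H by (simp add: Cauchy_filter_on_def filter_mult_eq_bot)
next
  fix U assume U: "nbhd1 U"
  obtain V where V: "nbhd1 V" "\<And>x y. x \<in> V \<Longrightarrow> y \<in> V \<Longrightarrow> x \<otimes> y \<in> U"
    using nbhd1_mult[OF U] by blast
  obtain g where g: "g \<in> carrier G" "\<forall>\<^sub>F x in F. x \<in> carrier G \<and> x \<otimes> inv g \<in> V"
    using F V(1) unfolding Cauchy_filter_iff by blast
  have "nbhd1 {z \<in> carrier G. g \<otimes> z \<otimes> inv g \<in> V}"
    using openin_conj_preimage[OF g(1)] V(1) g by simp
  then obtain h where h: "h \<in> carrier G"
      "\<forall>\<^sub>F x in H. x \<in> carrier G \<and> x \<otimes> inv h \<in> {z \<in> carrier G. g \<otimes> z \<otimes> inv g \<in> V}"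
    using H unfolding Cauchy_filter_iff by blast
  have "\<forall>\<^sub>F x in filter_mult G F H. x \<in> carrier G \<and> x \<otimes> inv (g \<otimes> h) \<in> U"
  proof (rule eventually_filter_multI[OF g(2) h(2)])
    fix x y assume x: "x \<in> carrier G \<and> x \<otimes> inv g \<in> V"
      and y: "y \<in> carrier G \<and> y \<otimes> inv h \<in> {z \<in> carrier G. g \<otimes> z \<otimes> inv g \<in> V}"
    then have "(x \<otimes> inv g) \<otimes> (g \<otimes> (y \<otimes> inv h) \<otimes> inv g) \<in> U" using V by blast
    also have "(x \<otimes> inv g) \<otimes> (g \<otimes> (y \<otimes> inv h) \<otimes> inv g) = x \<otimes> y \<otimes> inv (g \<otimes> h)"
      using x y g h by (simp add: inv_mult_group m_assoc flip: m_assoc[of "inv g" g])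
    finally show "x \<otimes> y \<in> carrier G \<and> x \<otimes> y \<otimes> inv (g \<otimes> h) \<in> U" using x y by simp
  qed
  then show "\<exists>g\<in>carrier G. \<forall>\<^sub>F x in filter_mult G F H. x \<in> carrier G \<and> x \<otimes> inv g \<in> U"
    using g h by blast
qed

lemma filter_mult_assoc:
  assumes "\<forall>\<^sub>F x in F. x \<in> carrier G" "\<forall>\<^sub>F x in H. x \<in> carrier G" "\<forall>\<^sub>F x in K. x \<in> carrier G"
  shows "filter_mult G (filter_mult G F H) K = filter_mult G F (filter_mult G H K)"
proof -
  have "filter_mult G (filter_mult G F H) K =
      filtermap (\<lambda>(x, y). x \<otimes> y) (filtermap (map_prod (\<lambda>(x, y). x \<otimes> y) id) ((F \<times>\<^sub>F H) \<times>\<^sub>F K))"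
    unfolding filter_mult_def by (subst filtermap_prod_filter) (simp_all add: filtermap_ident)
  also have "\<dots> = filtermap (\<lambda>(x, y, z). x \<otimes> y \<otimes> z) (F \<times>\<^sub>F (H \<times>\<^sub>F K))"
    by (simp add: prod_filter_assoc filtermap_filtermap case_prod_unfold)
  \<comment> \<open>The two functions are known to agree only on triples from the carrier, so
    equality of the image filters rests on the three hypotheses.\<close>
  also have "\<dots> = filtermap (\<lambda>(x, y, z). x \<otimes> (y \<otimes> z)) (F \<times>\<^sub>F (H \<times>\<^sub>F K))"
  proof -
    have "\<forall>\<^sub>F p in F \<times>\<^sub>F (H \<times>\<^sub>F K). fst p \<in> carrier G \<and> (fst (snd p) \<in> carrier G \<and> snd (snd p) \<in> carrier G)"
      by (intro eventually_prodI assms)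
    then have "\<forall>\<^sub>F p in F \<times>\<^sub>F (H \<times>\<^sub>F K).
        (case p of (x, y, z) \<Rightarrow> x \<otimes> y \<otimes> z) = (case p of (x, y, z) \<Rightarrow> x \<otimes> (y \<otimes> z))"
      by eventually_elim (auto simp: m_assoc)
    then show ?thesis
      unfolding filter_eq_iff eventually_filtermap
      by (auto elim: eventually_elim2)
  qed
  also have "\<dots> = filtermap (\<lambda>(x, y). x \<otimes> y) (filtermap (map_prod id (\<lambda>(x, y). x \<otimes> y)) (F \<times>\<^sub>F (H \<times>\<^sub>F K)))"
    by (simp add: filtermap_filtermap case_prod_unfold)
  also have "\<dots> = filter_mult G F (filter_mult G H K)"
    unfolding filter_mult_def by (subst filtermap_prod_filter) (simp_all add: filtermap_ident)
  finally show ?thesis .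
qed

section \<open>Neighbourhood filters and round Cauchy filters\<close>

lemma Cauchy_nhdsin:
  assumes "x \<in> carrier G"
  shows "Cauchy_filter_on \<U> (nhdsin T x)"
  unfolding Cauchy_filter_iff
proof (intro conjI allI impI)
  show "nhdsin T x \<noteq> bot"
    using assms by (auto simp: trivial_limit_def eventually_nhdsin)
next
  fix U assume "nbhd1 U"
  then have "openin T {y \<in> carrier G. y \<otimes> inv x \<in> U}" "x \<in> {y \<in> carrier G. y \<otimes> inv x \<in> U}"
    using openin_right_preimage[of "inv x" U] assms by auto
  then show "\<exists>g\<in>carrier G. \<forall>\<^sub>F y in nhdsin T x. y \<in> carrier G \<and> y \<otimes> inv g \<in> U"
    using assms by (intro bexI[of _ x]) (auto simp: eventually_nhdsin)
qed

text \<open>A member of \<open>F\<close> that is small for \<open>U\<close> meets each member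
  \<open>A\<close> of the finer filter \<open>K\<close>, hence lies in \<open>U A\<close>. So
  \<open>N K\<close> bounds every Cauchy filter coarser than \<open>K\<close>, which identifies it
  as the minimal one in Bourbaki's sense.\<close>

lemma Cauchy_le_filter_mult_nhdsin:
  assumes K: "Cauchy_filter_on \<U> K" and F: "Cauchy_filter_on \<U> F" and "K \<le> F"
  shows "F \<le> filter_mult G (nhdsin T \<one>) K"
proof (rule filter_leI)
  fix P assume "eventually P (filter_mult G (nhdsin T \<one>) K)"
  then obtain U A where U: "nbhd1 U" and A: "eventually A K"
      and P: "\<And>x y. x \<in> U \<Longrightarrow> A y \<Longrightarrow> P (x \<otimes> y)"
    unfolding eventually_filter_mult eventually_nhdsin_one by metis
  obtain M where M: "eventually M F"
      "\<And>x y. M x \<Longrightarrow> M y \<Longrightarrow> x \<in> carrier G \<and> y \<in> carrier G \<and> x \<otimes> inv y \<in> U"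
    using Cauchy_filter_small[OF F U] by blast
  have "eventually (\<lambda>x. M x \<and> A x) K"
    using A M(1) \<open>K \<le> F\<close> by (auto simp: le_filter_def intro: eventually_conj)
  then obtain b where b: "M b" "A b"
    using K eventually_happens' unfolding Cauchy_filter_on_def by blast
  show "eventually P F"
    using M(1)
  proof eventually_elim
    fix x assume "M x"
    then have x: "x \<in> carrier G" "b \<in> carrier G" "x \<otimes> inv b \<in> U" using M b by auto
    then have "P (x \<otimes> inv b \<otimes> b)" using P b by blast
    then show "P x" using x by (simp add: m_assoc)
  qed
qed

lemma le_filter_mult_nhdsin:
  assumes "\<forall>\<^sub>F x in K. x \<in> carrier G"
  shows "K \<le> filter_mult G (nhdsin T \<one>) K"
proof (rule filter_leI)
  fix P assume "eventually P (filter_mult G (nhdsin T \<one>) K)"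
  then obtain U A where U: "nbhd1 U" and A: "eventually A K"
      and P: "\<And>x y. x \<in> U \<Longrightarrow> A y \<Longrightarrow> P (x \<otimes> y)"
    unfolding eventually_filter_mult eventually_nhdsin_one by metis
  show "eventually P K" using A assms by eventually_elim (use P U in fastforce)
qed

text \<open>\<open>N F\<close> is a Cauchy filter coarser than \<open>F\<close>, so maximality
  forces equality; conversely, any Cauchy filter coarser than \<open>F\<close> is finer than
  \<open>N F\<close> by the bound above.\<close>

lemma completion_points_iff:
  "F \<in> completion_points \<U> \<longleftrightarrow>
     Cauchy_filter_on \<U> F \<and> filter_mult G (nhdsin T \<one>) F = F"
proof
  assume F: "F \<in> completion_points \<U>"
  then have C: "Cauchy_filter_on \<U> F" by (simp add: completion_points_def)
  then show "Cauchy_filter_on \<U> F \<and> filter_mult G (nhdsin T \<one>) F = F"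
    using F Cauchy_filter_mult[OF Cauchy_nhdsin[OF one_closed] C]
      le_filter_mult_nhdsin[OF Cauchy_eventually_carrier[OF C]]
    unfolding completion_points_def by blast
next
  assume F: "Cauchy_filter_on \<U> F \<and> filter_mult G (nhdsin T \<one>) F = F"
  then show "F \<in> completion_points \<U>"
    using Cauchy_le_filter_mult_nhdsin[of F] unfolding completion_points_def
    by (auto intro: antisym)
qed

lemma completion_pointsD:
  assumes "F \<in> completion_points \<U>"
  shows "Cauchy_filter_on \<U> F" "F \<noteq> bot" "\<forall>\<^sub>F x in F. x \<in> carrier G"
    "filter_mult G (nhdsin T \<one>) F = F"
  using assms Cauchy_eventually_carrier by (auto simp: completion_points_iff Cauchy_filter_on_def)

lemma completion_points_le_eq:
  "\<lbrakk>F \<in> completion_points \<U>; H \<in> completion_points \<U>; F \<le> H\<rbrakk> \<Longrightarrow> F = H"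
  unfolding completion_points_def by blast

text \<open>Roundness passes to products by associativity:
  \<open>N (F H) = (N F) H = F H\<close>.\<close>

lemma completion_points_mult:
  assumes "F \<in> completion_points \<U>" "H \<in> completion_points \<U>"
  shows "filter_mult G F H \<in> completion_points \<U>"
  using assms completion_pointsD[OF assms(1)] completion_pointsD[OF assms(2)]
  unfolding completion_points_iff
  by (metis Cauchy_eventually_carrier Cauchy_filter_mult Cauchy_nhdsin filter_mult_assoc one_closed)

lemma filter_mult_nhdsin_le:
  assumes "x \<in> carrier G" "y \<in> carrier G"
  shows "filter_mult G (nhdsin T x) (nhdsin T y) \<le> nhdsin T (x \<otimes> y)"
proof (rule filter_leI)
  fix P assume "eventually P (nhdsin T (x \<otimes> y))"
  then obtain U where U: "openin T U" "x \<otimes> y \<in> U" "\<And>z. z \<in> U \<Longrightarrow> P z"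
    using assms by (auto simp: eventually_nhdsin)
  have "openin (prod_topology T T) {p \<in> carrier G \<times> carrier G. fst p \<otimes> snd p \<in> U}"
    using openin_continuous_map_preimage
      [OF continuous_map_group_mult[OF continuous_map_fst continuous_map_snd] U(1)] by simp
  moreover have "(x, y) \<in> {p \<in> carrier G \<times> carrier G. fst p \<otimes> snd p \<in> U}"
    using assms U by simp
  ultimately obtain V W where "openin T V" "openin T W" "x \<in> V" "y \<in> W"
      "V \<times> W \<subseteq> {p \<in> carrier G \<times> carrier G. fst p \<otimes> snd p \<in> U}"
    unfolding openin_prod_topology_alt by meson
  then show "eventually P (filter_mult G (nhdsin T x) (nhdsin T y))"
    using U(3) by (intro eventually_filter_multI[of "\<lambda>x. x \<in> V" _ "\<lambda>x. x \<in> W"])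
      (auto simp: eventually_nhdsin)
qed

text \<open>Continuity of the product at \<open>(\<one>, x)\<close> gives the nontrivial inequality
  of roundness.\<close>

lemma nhdsin_completion_point:
  assumes "x \<in> carrier G"
  shows "nhdsin T x \<in> completion_points \<U>"
proof -
  have "filter_mult G (nhdsin T \<one>) (nhdsin T x) \<le> nhdsin T x"
    using filter_mult_nhdsin_le[OF one_closed assms] assms by simp
  then show ?thesis
    using le_filter_mult_nhdsin Cauchy_eventually_carrier Cauchy_nhdsin[OF assms]
    unfolding completion_points_iff by (blast intro: antisym)
qed

lemma completion_point_round:
  assumes "F \<in> completion_points \<U>" "eventually P F"
  obtains U A where "nbhd1 U" "eventually A F" "\<And>x y. x \<in> U \<Longrightarrow> A y \<Longrightarrow> P (x \<otimes> y)"
proof -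
  have "eventually P (filter_mult G (nhdsin T \<one>) F)"
    using assms completion_pointsD(4) by simp
  then show ?thesis
    unfolding eventually_filter_mult eventually_nhdsin_one using that by metis
qed

section \<open>Topology of the completion\<close>

lemma eventually_completion_uniformity:
  "eventually P (completion_uniformity \<U>) \<longleftrightarrow>
     (\<exists>E. (\<forall>\<^sub>F p in \<U>. p \<in> E) \<and> (\<forall>p\<in>completion_entourage \<U> E. P p))"
  unfolding completion_uniformity_def
proof (subst eventually_INF_base)
  fix E E' assume "E \<in> {E. \<forall>\<^sub>F p in \<U>. p \<in> E}" "E' \<in> {E. \<forall>\<^sub>F p in \<U>. p \<in> E}"
  then show "\<exists>D\<in>{E. \<forall>\<^sub>F p in \<U>. p \<in> E}. principal (completion_entourage \<U> D) \<le>
      inf (principal (completion_entourage \<U> E)) (principal (completion_entourage \<U> E'))"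
    by (intro bexI[of _ "E \<inter> E'"]) (auto simp: completion_entourage_def eventually_conj)
next
  have "UNIV \<in> {E. \<forall>\<^sub>F p in \<U>. p \<in> E}" by simp
  then show "{E. \<forall>\<^sub>F p in \<U>. p \<in> E} \<noteq> {}" by blast
qed (auto simp: eventually_principal)

text \<open>Since the points are round filters, the sets of all points containing a given set form a
  base; this base replaces the entourages from here on.\<close>

lemma openin_completion_topology:
  "openin (completion_topology \<U>) W \<longleftrightarrow>
     W \<subseteq> completion_points \<U> \<and>
     (\<forall>F\<in>W. \<exists>M. eventually M F \<and> (\<forall>H\<in>completion_points \<U>. eventually M H \<longrightarrow> H \<in> W))"
    (is "_ \<longleftrightarrow> _ \<and> ?R")
proof -
  have "(\<forall>\<^sub>F p in completion_uniformity \<U>. fst p = F \<longrightarrow> snd p \<in> W) \<longleftrightarrow>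
      (\<exists>M. eventually M F \<and> (\<forall>H\<in>completion_points \<U>. eventually M H \<longrightarrow> H \<in> W))" (is "?A \<longleftrightarrow> ?B")
    if F: "F \<in> completion_points \<U>" for F
  proof
    assume ?A
    then obtain E where E: "\<forall>\<^sub>F p in \<U>. p \<in> E"
        "\<And>H. (F, H) \<in> completion_entourage \<U> E \<Longrightarrow> H \<in> W"
      unfolding eventually_completion_uniformity by fastforce
    then have "\<forall>\<^sub>F p in F \<times>\<^sub>F F. p \<in> E"
      using completion_pointsD(1)[OF F] by (auto simp: Cauchy_filter_on_def le_filter_def)
    then obtain M where "eventually M F" "\<And>x y. M x \<Longrightarrow> M y \<Longrightarrow> (x, y) \<in> E"
      unfolding eventually_prod_same by blast
    then have "H \<in> W" if "H \<in> completion_points \<U>" "eventually M H" for H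
      using that F by (intro E(2)) (auto simp: completion_entourage_def intro!: exI[of _ "Collect M"])
    then show ?B using \<open>eventually M F\<close> by blast
  next
    assume ?B
    then obtain M where M: "eventually M F"
        "\<And>H. H \<in> completion_points \<U> \<Longrightarrow> eventually M H \<Longrightarrow> H \<in> W" by blast
    obtain U A where U: "nbhd1 U" and A: "eventually A F"
        and UA: "\<And>x y. x \<in> U \<Longrightarrow> A y \<Longrightarrow> M (x \<otimes> y)"
      using completion_point_round[OF F M(1)] by blast
    define E where "E = {(x, y). x \<in> carrier G \<and> y \<in> carrier G \<and> x \<otimes> inv y \<in> U}"
    have "\<forall>\<^sub>F p in \<U>. p \<in> E"
      unfolding eventually_right_uniformity E_def using U by blast
    moreover have "H \<in> W" if "(F, H) \<in> completion_entourage \<U> E" for H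
    proof -
      obtain B where H: "H \<in> completion_points \<U>" and B: "\<forall>\<^sub>F x in F. x \<in> B"
          "\<forall>\<^sub>F x in H. x \<in> B" "B \<times> B \<subseteq> E"
        using \<open>(F, H) \<in> completion_entourage \<U> E\<close> by (auto simp: completion_entourage_def)
      \<comment> \<open>The small set \<open>B\<close> meets \<open>A\<close> in \<open>b\<close>,
        so \<open>B \<subseteq> U b\<close> lies inside \<open>M\<close>.\<close>
      obtain b where b: "A b" "b \<in> B"
        using eventually_happens'[OF completion_pointsD(2)[OF F] eventually_conj[OF A B(1)]] by blast
      have "eventually M H"
        using B(2)
      proof eventually_elim
        fix x assume "x \<in> B"
        then have x: "x \<in> carrier G" "b \<in> carrier G" "x \<otimes> inv b \<in> U"
          using B(3) b by (auto simp: E_def)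
        then have "M (x \<otimes> inv b \<otimes> b)" using UA b by blast
        then show "M x" using x by (simp add: m_assoc)
      qed
      then show ?thesis using M(2) H by blast
    qed
    ultimately show ?A
      unfolding eventually_completion_uniformity by fastforce
  qed
  then show ?thesis
    unfolding completion_topology_def openin_uniform_topology by blast
qed

lemma openin_completion_basic:
  "openin (completion_topology \<U>) {F \<in> completion_points \<U>. eventually P F}"
  by (auto simp: openin_completion_topology)

text \<open>The infimum of the two filters is proper and finer than a Cauchy filter, hence Cauchy;
  each of the two points must then equal \<open>N\<close> times this infimum.\<close>

lemma completion_points_separated:
  assumes F: "F \<in> completion_points \<U>" and H: "H \<in> completion_points \<U>" and "inf F H \<noteq> bot"
  shows "F = H"
proof -
  let ?K = "inf F H"
  have K: "Cauchy_filter_on \<U> ?K"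
    using completion_pointsD(1)[OF F] \<open>?K \<noteq> bot\<close> prod_filter_mono[of ?K F ?K F]
    by (auto simp: Cauchy_filter_on_def intro: order_trans)
  have "E = filter_mult G (nhdsin T \<one>) ?K" if "E \<in> completion_points \<U>" "?K \<le> E" for E
    using Cauchy_le_filter_mult_nhdsin[OF K] completion_pointsD[OF that(1)] that(2)
      filter_mult_mono[OF order_refl that(2), of G "nhdsin T \<one>"] by (metis antisym)
  from this[OF F] this[OF H] show ?thesis by simp
qed

lemma Hausdorff_completion: "Hausdorff_space (completion_topology \<U>)"
  unfolding Hausdorff_space_def topspace_completion_topology
proof (intro allI impI, elim conjE)
  fix F H assume FH: "F \<in> completion_points \<U>" "H \<in> completion_points \<U>" "F \<noteq> H"
  then have "eventually (\<lambda>_. False) (inf F H)"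
    using completion_points_separated by (auto simp: trivial_limit_def)
  then obtain P Q where PQ: "eventually P F" "eventually Q H" "\<And>x. P x \<and> Q x \<Longrightarrow> False"
    unfolding eventually_inf by blast
  have "disjnt {K \<in> completion_points \<U>. eventually P K} {K \<in> completion_points \<U>. eventually Q K}"
  proof (clarsimp simp: disjnt_iff)
    fix K assume K: "K \<in> completion_points \<U>" "eventually P K" "eventually Q K"
    then show False
      using eventually_happens'[OF completion_pointsD(2)[OF K(1)] eventually_conj[OF K(2,3)]] PQ by blast
  qed
  then show "\<exists>U V. openin (completion_topology \<U>) U \<and> openin (completion_topology \<U>) V \<and>
      F \<in> U \<and> H \<in> V \<and> disjnt U V"
    using FH PQ openin_completion_basic by blast
qed

text \<open>A member \<open>M\<close> of a round filter contains some \<open>U A\<close>, hence the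
  neighbourhood \<open>U b\<close> of any group element \<open>b\<close> in
  \<open>A\<close>.\<close>

lemma dense_nhdsin:
  "completion_topology \<U> closure_of (nhdsin T ` carrier G) = completion_points \<U>"
proof -
  have "F \<in> completion_topology \<U> closure_of (nhdsin T ` carrier G)" if F: "F \<in> completion_points \<U>" for F
    unfolding in_closure_of topspace_completion_topology
  proof (intro conjI allI impI F)
    fix W assume "F \<in> W \<and> openin (completion_topology \<U>) W"
    then obtain M where M: "eventually M F" "\<And>H. \<lbrakk>H \<in> completion_points \<U>; eventually M H\<rbrakk> \<Longrightarrow> H \<in> W"
      unfolding openin_completion_topology by blast
    obtain U A where U: "nbhd1 U" and A: "eventually A F"
        and UA: "\<And>x y. x \<in> U \<Longrightarrow> A y \<Longrightarrow> M (x \<otimes> y)"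
      using completion_point_round[OF F M(1)] by blast
    obtain b where b: "A b" "b \<in> carrier G"
      using eventually_happens'[OF completion_pointsD(2)[OF F]
          eventually_conj[OF A completion_pointsD(3)[OF F]]] by blast
    let ?V = "{x \<in> carrier G. x \<otimes> inv b \<in> U}"
    have "openin T ?V" "b \<in> ?V" using openin_right_preimage[of "inv b" U] U b by auto
    moreover have "M x" if "x \<in> ?V" for x
      using UA[of "x \<otimes> inv b" b] that b by (simp add: m_assoc)
    ultimately have "eventually M (nhdsin T b)"
      unfolding eventually_nhdsin by blast
    then show "\<exists>y. y \<in> nhdsin T ` carrier G \<and> y \<in> W"
      using M(2) nhdsin_completion_point b by blast
  qed
  then show ?thesis
    using closure_of_subset_topspace[of "completion_topology \<U>"]
    by (auto simp: topspace_completion_topology)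
qed

lemma continuous_map_nhdsin: "continuous_map T (completion_topology \<U>) (nhdsin T)"
  unfolding continuous_map_def topspace_completion_topology
proof (intro conjI allI impI)
  fix W assume W: "openin (completion_topology \<U>) W"
  show "openin T {x \<in> topspace T. nhdsin T x \<in> W}"
  proof (subst openin_subopen, clarsimp)
    fix x assume "x \<in> carrier G" "nhdsin T x \<in> W"
    then obtain M where M: "eventually M (nhdsin T x)"
        "\<And>H. \<lbrakk>H \<in> completion_points \<U>; eventually M H\<rbrakk> \<Longrightarrow> H \<in> W"
      using W unfolding openin_completion_topology by blast
    then obtain S where S: "openin T S" "x \<in> S" "\<And>y. y \<in> S \<Longrightarrow> M y"
      using \<open>x \<in> carrier G\<close> by (auto simp: eventually_nhdsin)
    have "nhdsin T y \<in> W" if "y \<in> S" for y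
      using that S nhdsin_completion_point[OF open_subset_carrier[OF S(1)]]
      by (intro M(2)) (auto simp: eventually_nhdsin)
    then show "\<exists>S. openin T S \<and> x \<in> S \<and> S \<subseteq> {x \<in> carrier G. nhdsin T x \<in> W}"
      using S open_subset_carrier by blast
  qed
qed (use nhdsin_completion_point in auto)

section \<open>Multiplication of the completion\<close>

lemma filter_mult_nhdsin:
  assumes "x \<in> carrier G" "y \<in> carrier G"
  shows "filter_mult G (nhdsin T x) (nhdsin T y) = nhdsin T (x \<otimes> y)"
  using assms by (intro completion_points_le_eq filter_mult_nhdsin_le)
    (auto intro: completion_points_mult nhdsin_completion_point)

text \<open>Multiplying by \<open>N\<close> on the left is roundness, but on the right only
  \<open>F \<le> F N\<close> is immediate; since \<open>F N\<close> is again a point, maximality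
  gives equality.\<close>

lemma filter_mult_one_right:
  assumes F: "F \<in> completion_points \<U>"
  shows "filter_mult G F (nhdsin T \<one>) = F"
proof -
  have "F \<le> filter_mult G F (nhdsin T \<one>)"
  proof (rule filter_leI)
    fix P assume "eventually P (filter_mult G F (nhdsin T \<one>))"
    then obtain A U where A: "eventually A F" and U: "nbhd1 U"
        and P: "\<And>x y. A x \<Longrightarrow> y \<in> U \<Longrightarrow> P (x \<otimes> y)"
      unfolding eventually_filter_mult eventually_nhdsin_one by metis
    show "eventually P F"
      using A completion_pointsD(3)[OF F] by eventually_elim (metis P U r_one)
  qed
  then show ?thesis
    using completion_points_le_eq[OF F] completion_points_mult[OF F nhdsin_completion_point]
    by (metis one_closed)
qed

text \<open>A member of \<open>F H\<close> contains a product \<open>A B\<close>, and the points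
  containing \<open>A\<close> and those containing \<open>B\<close> form the required
  neighbourhoods.\<close>

lemma continuous_map_filter_mult:
  "continuous_map (prod_topology (completion_topology \<U>) (completion_topology \<U>))
     (completion_topology \<U>) (\<lambda>(F, H). filter_mult G F H)"
  unfolding continuous_map_def topspace_completion_topology topspace_prod_topology
proof (intro conjI allI impI)
  fix W assume W: "openin (completion_topology \<U>) W"
  show "openin (prod_topology (completion_topology \<U>) (completion_topology \<U>))
      {p \<in> completion_points \<U> \<times> completion_points \<U>. (case p of (F, H) \<Rightarrow> filter_mult G F H) \<in> W}"
    unfolding openin_prod_topology_alt
  proof (intro allI impI)
    fix F H assume "(F, H) \<in> {p \<in> completion_points \<U> \<times> completion_points \<U>.
        (case p of (F, H) \<Rightarrow> filter_mult G F H) \<in> W}"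
    then have F: "F \<in> completion_points \<U>" and H: "H \<in> completion_points \<U>"
        and FH: "filter_mult G F H \<in> W" by auto
    from FH W obtain M where M: "eventually M (filter_mult G F H)"
        "\<And>K. \<lbrakk>K \<in> completion_points \<U>; eventually M K\<rbrakk> \<Longrightarrow> K \<in> W"
      unfolding openin_completion_topology by blast
    from M(1) obtain A B where AB: "eventually A F" "eventually B H" "\<And>x y. A x \<Longrightarrow> B y \<Longrightarrow> M (x \<otimes> y)"
      unfolding eventually_filter_mult by blast
    have "{F \<in> completion_points \<U>. eventually A F} \<times> {F \<in> completion_points \<U>. eventually B F} \<subseteq>
        {p \<in> completion_points \<U> \<times> completion_points \<U>. (case p of (F, H) \<Rightarrow> filter_mult G F H) \<in> W}"
      using AB(3) by (auto intro!: M(2) completion_points_mult intro: eventually_filter_multI)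
    then show "\<exists>U V. openin (completion_topology \<U>) U \<and> openin (completion_topology \<U>) V \<and>
        F \<in> U \<and> H \<in> V \<and> U \<times> V \<subseteq> {p \<in> completion_points \<U> \<times> completion_points \<U>.
          (case p of (F, H) \<Rightarrow> filter_mult G F H) \<in> W}"
      using openin_completion_basic F H AB by blast
  qed
qed (auto intro: completion_points_mult)

end

text \<open>The predicate under the definite description in \<open>completion_mult\<close>, named so
  that existence and uniqueness can be carried between a group and its opposite.\<close>

definition extends_mult ::
  "('a, 'b) monoid_scheme \<Rightarrow> 'a topology \<Rightarrow> ('a \<times> 'a) filter \<Rightarrow>
     ('a filter \<times> 'a filter \<Rightarrow> 'a filter) \<Rightarrow> bool" where
  "extends_mult G T \<U> m \<longleftrightarrow>
     m \<in> extensional (completion_points \<U> \<times> completion_points \<U>) \<and>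
     continuous_map (prod_topology (completion_topology \<U>) (completion_topology \<U>))
       (completion_topology \<U>) m \<and>
     (\<forall>x\<in>carrier G. \<forall>y\<in>carrier G. m (nhdsin T x, nhdsin T y) = nhdsin T (x \<otimes>\<^bsub>G\<^esub> y))"

lemma completion_mult_eqI:
  assumes "extends_mult G T \<U> m" and "\<And>m'. extends_mult G T \<U> m' \<Longrightarrow> m' = m"
  shows "completion_mult G T \<U> = m"
  unfolding completion_mult_def extends_mult_def[symmetric] using assms by (rule the_equality)

context top_group
begin

definition completion_times :: "'a filter \<times> 'a filter \<Rightarrow> 'a filter" where
  "completion_times =
     restrict (\<lambda>(F, H). filter_mult G F H) (completion_points \<U> \<times> completion_points \<U>)"

lemma extends_mult_completion_times: "extends_mult G T \<U> completion_times"
  unfolding extends_mult_def completion_times_def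
proof (intro conjI)
  show "continuous_map (prod_topology (completion_topology \<U>) (completion_topology \<U>))
      (completion_topology \<U>)
      (restrict (\<lambda>(F, H). filter_mult G F H) (completion_points \<U> \<times> completion_points \<U>))"
    by (rule continuous_map_eq[OF continuous_map_filter_mult])
      (auto simp: topspace_completion_topology)
qed (auto simp: nhdsin_completion_point filter_mult_nhdsin)

text \<open>Continuous maps into a Hausdorff space that agree on the dense image of
  \<open>G \<times> G\<close> agree on the whole square; outside it extensionality fixes both
  values.\<close>

lemma extends_mult_unique:
  assumes "extends_mult G T \<U> m"
  shows "m = completion_times"
proof (rule extensionalityI)
  fix p assume "p \<in> completion_points \<U> \<times> completion_points \<U>"
  then have "p \<in> prod_topology (completion_topology \<U>) (completion_topology \<U>) closure_of
      (nhdsin T ` carrier G \<times> nhdsin T ` carrier G)"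
    by (simp add: closure_of_Times dense_nhdsin)
  then show "m p = completion_times p"
    by (rule forall_in_closure_of_eq[OF _ Hausdorff_completion])
      (use assms extends_mult_completion_times in \<open>auto simp: extends_mult_def\<close>)
qed (use assms extends_mult_completion_times in \<open>auto simp: extends_mult_def\<close>)

lemma completion_mult_eq: "completion_mult G T \<U> = completion_times"
  using completion_mult_eqI extends_mult_completion_times extends_mult_unique by metis

abbreviation S :: "'a filter monoid" where
  "S \<equiv> completion_monoid G T \<U>"

lemma carrier_completion [simp]: "carrier S = completion_points \<U>"
  by (simp add: completion_monoid_def)

lemma one_completion [simp]: "\<one>\<^bsub>S\<^esub> = nhdsin T \<one>"
  by (simp add: completion_monoid_def)

lemma mult_completion:
  "\<lbrakk>F \<in> completion_points \<U>; H \<in> completion_points \<U>\<rbrakk> \<Longrightarrow> F \<otimes>\<^bsub>S\<^esub> H = filter_mult G F H"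
  by (simp add: completion_monoid_def completion_mult_eq completion_times_def)

lemma monoid_completion: "monoid S"
  by (rule monoidI)
    (simp_all add: mult_completion completion_points_mult nhdsin_completion_point
      filter_mult_assoc completion_pointsD filter_mult_one_right)

lemma continuous_map_completion_mult:
  "continuous_map (prod_topology (completion_topology \<U>) (completion_topology \<U>))
     (completion_topology \<U>) (\<lambda>(F, H). F \<otimes>\<^bsub>S\<^esub> H)"
  by (rule continuous_map_eq[OF continuous_map_filter_mult])
    (auto simp: topspace_completion_topology mult_completion)

end

section \<open>Stone spaces\<close>

lemma continuous_map_discreteI:
  assumes "\<And>x. x \<in> topspace X \<Longrightarrow> \<exists>U. openin X U \<and> x \<in> U \<and> (\<forall>z\<in>U. f z = f x)"
  shows "continuous_map X (discrete_topology UNIV) f"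
  unfolding continuous_map_def
proof (intro conjI allI impI)
  fix W
  show "openin X {x \<in> topspace X. f x \<in> W}"
  proof (subst openin_subopen, intro ballI)
    fix x assume x: "x \<in> {x \<in> topspace X. f x \<in> W}"
    then obtain U where U: "openin X U" "x \<in> U" "\<forall>z\<in>U. f z = f x" using assms by blast
    have "z \<in> topspace X \<and> f z \<in> W" if "z \<in> U" for z
    proof -
      have "f z = f x" using U(3) that by blast
      then show ?thesis using x that openin_subset[OF U(1)] by auto
    qed
    then have "U \<subseteq> {x \<in> topspace X. f x \<in> W}" by blast
    then show "\<exists>U. openin X U \<and> x \<in> U \<and> U \<subseteq> {x \<in> topspace X. f x \<in> W}" using U by blast
  qed
qed simp

lemma embedding_mapI:
  assumes cont: "continuous_map X Y f" and inj: "inj_on f (topspace X)"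
    and nbhd: "\<And>W x. \<lbrakk>openin X W; x \<in> W\<rbrakk> \<Longrightarrow>
      \<exists>V. openin Y V \<and> f x \<in> V \<and> (\<forall>z\<in>topspace X. f z \<in> V \<longrightarrow> z \<in> W)"
  shows "embedding_map X Y f"
  unfolding embedding_map_def
proof (rule bijective_open_imp_homeomorphic_map)
  show "continuous_map X (subtopology Y (f ` topspace X)) f"
    using cont by (simp add: continuous_map_in_subtopology)
  show "f ` topspace X = topspace (subtopology Y (f ` topspace X))"
    using continuous_map_image_subset_topspace[OF cont] by auto
  show "open_map X (subtopology Y (f ` topspace X)) f"
    unfolding open_map_def
  proof (intro allI impI)
    fix W assume W: "openin X W"
    show "openin (subtopology Y (f ` topspace X)) (f ` W)"
    proof (subst openin_subopen, intro ballI)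
      fix y assume "y \<in> f ` W"
      then obtain x where x: "x \<in> W" "y = f x" by blast
      then obtain V where V: "openin Y V" "f x \<in> V" "\<And>z. \<lbrakk>z \<in> topspace X; f z \<in> V\<rbrakk> \<Longrightarrow> z \<in> W"
        using nbhd[OF W x(1)] by blast
      have "openin (subtopology Y (f ` topspace X)) (V \<inter> f ` topspace X)"
        using V(1) by (auto simp: openin_subtopology)
      moreover have "y \<in> V \<inter> f ` topspace X" "V \<inter> f ` topspace X \<subseteq> f ` W"
        using x V openin_subset[OF W] by auto
      ultimately show "\<exists>S. openin (subtopology Y (f ` topspace X)) S \<and> y \<in> S \<and> S \<subseteq> f ` W"
        by blast
    qed
  qed
qed (use inj in auto)

lemma embedding_map_open_preimage:
  assumes f: "embedding_map X Y f" and W: "openin X W"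
  obtains V where "openin Y V" "\<And>x. x \<in> topspace X \<Longrightarrow> f x \<in> V \<longleftrightarrow> x \<in> W"
proof -
  have h: "homeomorphic_map X (subtopology Y (f ` topspace X)) f"
    using f by (simp add: embedding_map_def)
  then have "openin (subtopology Y (f ` topspace X)) (f ` W)" "inj_on f (topspace X)"
    using W unfolding homeomorphic_eq_everything_map open_map_def by blast+
  then obtain V where V: "openin Y V" "f ` W = V \<inter> f ` topspace X"
    unfolding openin_subtopology by blast
  then have "f x \<in> V \<longleftrightarrow> x \<in> W" if "x \<in> topspace X" for x
    using that \<open>inj_on f (topspace X)\<close> openin_subset[OF W] by (auto simp: inj_on_def)
  then show ?thesis using that V(1) by blast
qed

lemma Stone_space_closed_subtopology:
  assumes X: "Stone_space X" and C: "closedin X C"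
  shows "Stone_space (subtopology X C)"
proof -
  obtain \<B> where B: "\<forall>D\<in>\<B>. openin X D \<and> closedin X D"
      "\<forall>U y. openin X U \<and> y \<in> U \<longrightarrow> (\<exists>D\<in>\<B>. y \<in> D \<and> D \<subseteq> U)"
    using X unfolding Stone_space_def by blast
  have "\<forall>D\<in>(\<lambda>D. D \<inter> C) ` \<B>. openin (subtopology X C) D \<and> closedin (subtopology X C) D"
    using B(1) by (auto simp: openin_subtopology closedin_subtopology)
  moreover have "\<exists>D\<in>(\<lambda>D. D \<inter> C) ` \<B>. y \<in> D \<and> D \<subseteq> U" if U: "openin (subtopology X C) U" "y \<in> U" for U y
  proof -
    obtain V where V: "openin X V" "U = V \<inter> C" using U(1) by (auto simp: openin_subtopology)
    then obtain D where "D \<in> \<B>" "y \<in> D" "D \<subseteq> V" using B(2) U by blast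
    then show ?thesis using V U by (intro bexI[of _ "D \<inter> C"]) auto
  qed
  ultimately show ?thesis
    using X compact_space_subtopology[OF closedin_compact_space[OF _ C]]
    unfolding Stone_space_def
    by (intro conjI exI[of _ "(\<lambda>D. D \<inter> C) ` \<B>"]) (auto simp: Hausdorff_space_subtopology)
qed

text \<open>Every box is closed because its sides are; the basic boxes, with finitely many proper
  sides, are open as well.\<close>

lemma Stone_space_Cantor_cube:
  "Stone_space (product_topology (\<lambda>_. discrete_topology (UNIV :: bool set)) I)" (is "Stone_space ?X")
  unfolding Stone_space_def
proof (intro conjI exI[of _ "{C. openin ?X C \<and> closedin ?X C}"] ballI allI impI)
  show "compact_space ?X"
    by (simp add: compact_space_product_topology compact_space_discrete_topology)
  show "Hausdorff_space ?X"
    by (simp add: Hausdorff_space_product_topology)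
  fix U y assume "openin ?X U \<and> y \<in> U"
  then obtain V where V: "finite {i \<in> I. V i \<noteq> topspace (discrete_topology (UNIV :: bool set))}"
      "y \<in> PiE I V" "PiE I V \<subseteq> U"
    unfolding openin_product_topology_alt by meson
  then have "openin ?X (PiE I V)"
    unfolding openin_PiE_gen by simp
  moreover have "closedin ?X (PiE I V)"
    by (simp add: closedin_product_topology)
  ultimately show "\<exists>C\<in>{C. openin ?X C \<and> closedin ?X C}. y \<in> C \<and> C \<subseteq> U"
    using V by blast
qed auto

lemma Stone_imp_completely_regular_space: "Stone_space X \<Longrightarrow> completely_regular_space X"
  unfolding Stone_space_def
  by (intro normal_imp_completely_regular_space compact_Hausdorff_or_regular_imp_normal_space) blast+

lemma completely_regular_space_embedding:
  "\<lbrakk>embedding_map X Y f; completely_regular_space Y\<rbrakk> \<Longrightarrow> completely_regular_space X"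
  using homeomorphic_completely_regular_space[OF embedding_map_imp_homeomorphic_space]
    completely_regular_space_subtopology by metis

text \<open>This is how a coordinate in the Cantor cube, given by a condition on almost all
  elements, is turned into a plain truth value.\<close>

lemma eventually_constant_iff:
  assumes "F \<noteq> bot" "\<forall>\<^sub>F x in F. Q x \<longleftrightarrow> c"
  shows "eventually Q F \<longleftrightarrow> c"
proof -
  have "eventually Q F \<longleftrightarrow> eventually (\<lambda>_. c) F"
    using assms(2) by (rule eventually_cong) simp
  then show ?thesis using assms(1) by (simp add: eventually_const)
qed

section \<open>Non-archimedean groups and actions on Stone spaces\<close>

context top_group
begin

text \<open>The subsets of \<open>G\<close> that are clopen for the right uniformity when \<open>G\<close> is non-archimedean.\<close>

definition uclopens :: "'a set set" where
  "uclopens =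
     {A. A \<subseteq> carrier G \<and> (\<exists>H. subgroup H G \<and> openin T H \<and> (\<forall>h\<in>H. \<forall>a\<in>A. h \<otimes> a \<in> A))}"

text \<open>This is \<open>g^-1 A\<close>, written as a preimage; composing translates therefore
  reverses the order of the elements.\<close>

definition translate :: "'a \<Rightarrow> 'a set \<Rightarrow> 'a set" where
  "translate g A = {x \<in> carrier G. g \<otimes> x \<in> A}"

lemma translate_one: "A \<in> uclopens \<Longrightarrow> translate \<one> A = A"
  by (auto simp: translate_def uclopens_def)

lemma translate_mult:
  "g \<in> carrier G \<Longrightarrow> h \<in> carrier G \<Longrightarrow> translate (g \<otimes> h) A = translate h (translate g A)"
  by (auto simp: translate_def m_assoc)

lemma subgroup_conj_preimage:
  assumes H: "subgroup H G" and g: "g \<in> carrier G"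
  shows "subgroup {z \<in> carrier G. g \<otimes> z \<otimes> inv g \<in> H} G"
proof (rule subgroupI)
  show "{z \<in> carrier G. g \<otimes> z \<otimes> inv g \<in> H} \<noteq> {}"
    using subgroup.one_closed[OF H] g by (auto intro!: exI[of _ \<one>])
next
  fix a assume a: "a \<in> {z \<in> carrier G. g \<otimes> z \<otimes> inv g \<in> H}"
  then have "inv (g \<otimes> a \<otimes> inv g) \<in> H" using subgroup.m_inv_closed[OF H] by blast
  then show "inv a \<in> {z \<in> carrier G. g \<otimes> z \<otimes> inv g \<in> H}"
    using a g by (simp add: inv_mult_group m_assoc)
next
  fix a b assume a: "a \<in> {z \<in> carrier G. g \<otimes> z \<otimes> inv g \<in> H}"
    and b: "b \<in> {z \<in> carrier G. g \<otimes> z \<otimes> inv g \<in> H}"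
  then have "(g \<otimes> a \<otimes> inv g) \<otimes> (g \<otimes> b \<otimes> inv g) \<in> H" using subgroup.m_closed[OF H] by blast
  also have "(g \<otimes> a \<otimes> inv g) \<otimes> (g \<otimes> b \<otimes> inv g) = g \<otimes> (a \<otimes> b) \<otimes> inv g"
    using a b g by (simp add: m_assoc flip: m_assoc[of "inv g" g])
  finally show "a \<otimes> b \<in> {z \<in> carrier G. g \<otimes> z \<otimes> inv g \<in> H}" using a b by simp
qed auto

text \<open>If \<open>H\<close> leaves \<open>A\<close> invariant, its conjugate
  \<open>g^-1 H g\<close>, again an open subgroup, leaves \<open>g^-1 A\<close> invariant.\<close>

lemma translate_uclopens:
  assumes A: "A \<in> uclopens" and g: "g \<in> carrier G"
  shows "translate g A \<in> uclopens"
proof -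
  obtain H where H: "subgroup H G" "openin T H" "\<And>h a. h \<in> H \<Longrightarrow> a \<in> A \<Longrightarrow> h \<otimes> a \<in> A"
    using A by (auto simp: uclopens_def)
  let ?K = "{z \<in> carrier G. g \<otimes> z \<otimes> inv g \<in> H}"
  have "h \<otimes> a \<in> translate g A" if h: "h \<in> ?K" and a: "a \<in> translate g A" for h a
  proof -
    have "(g \<otimes> h \<otimes> inv g) \<otimes> (g \<otimes> a) \<in> A" using H(3) h a by (auto simp: translate_def)
    also have "(g \<otimes> h \<otimes> inv g) \<otimes> (g \<otimes> a) = g \<otimes> (h \<otimes> a)"
      using h a g by (simp add: translate_def m_assoc flip: m_assoc[of "inv g" g])
    finally show ?thesis using h a by (simp add: translate_def)
  qed
  then show ?thesis
    using subgroup_conj_preimage[OF H(1) g] openin_conj_preimage[OF g H(2)]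
    by (auto simp: uclopens_def translate_def)
qed

text \<open>The translate is all that the action reads of \<open>x\<close> at coordinate
  \<open>A\<close>, and membership in \<open>A\<close> is all that the embedding reads.\<close>

definition indist :: "'a set \<Rightarrow> 'a \<Rightarrow> 'a \<Rightarrow> bool" where
  "indist A g x \<longleftrightarrow> x \<in> carrier G \<and> translate x A = translate g A \<and> (x \<in> A \<longleftrightarrow> g \<in> A)"

text \<open>A set invariant under the open subgroup \<open>H\<close> does not distinguish the points of a coset
  \<open>H g\<close>, and a Cauchy filter contains such a coset.\<close>

lemma completion_point_coset:
  assumes F: "F \<in> completion_points \<U>" and A: "A \<in> uclopens"
  obtains g where "g \<in> carrier G" "eventually (indist A g) F"
proof -
  obtain H where H: "subgroup H G" "openin T H" "\<And>h a. h \<in> H \<Longrightarrow> a \<in> A \<Longrightarrow> h \<otimes> a \<in> A"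
      and AG: "A \<subseteq> carrier G"
    using A by (auto simp: uclopens_def)
  \<comment> \<open>Invariance is given only as an inclusion; applying it to the inverse of
    \<open>h\<close> makes it an equivalence.\<close>
  have inv: "h \<otimes> a \<in> A \<longleftrightarrow> a \<in> A" if "h \<in> H" "a \<in> carrier G" for h a
    using H(3)[OF subgroup.m_inv_closed[OF H(1) that(1)], of "h \<otimes> a"] H(3)[OF that(1)]
      subgroup.mem_carrier[OF H(1) that(1)] that by (auto simp flip: m_assoc)
  obtain g where g: "g \<in> carrier G" "\<forall>\<^sub>F x in F. x \<in> carrier G \<and> x \<otimes> inv g \<in> H"
    using completion_pointsD(1)[OF F] H(2) subgroup.one_closed[OF H(1)]
    unfolding Cauchy_filter_iff by blast
  have same: "x \<otimes> a \<in> A \<longleftrightarrow> g \<otimes> a \<in> A"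
    if "x \<in> carrier G" "x \<otimes> inv g \<in> H" "a \<in> carrier G" for x a
    using inv[OF that(2), of "g \<otimes> a"] that g by (simp add: m_assoc flip: m_assoc[of "inv g" g])
  have "eventually (indist A g) F"
    using g(2)
  proof eventually_elim
    fix x assume "x \<in> carrier G \<and> x \<otimes> inv g \<in> H"
    \<comment> \<open>The instance with \<open>a = \<one>\<close> yields the membership clause, the
      general one the equality of translates.\<close>
    then show "indist A g x"
      using same[of x] same[of x \<one>] g(1) by (auto simp: indist_def translate_def)
  qed
  then show ?thesis using that g(1) by blast
qed

section \<open>The Cantor cube: action and embedding of the completion\<close>

definition cube :: "('a set \<Rightarrow> bool) topology" where
  "cube = product_topology (\<lambda>_. discrete_topology UNIV) uclopens"

definition cube_act :: "'a filter \<Rightarrow> ('a set \<Rightarrow> bool) \<Rightarrow> 'a set \<Rightarrow> bool" where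
  "cube_act F y = (\<lambda>A\<in>uclopens. \<forall>\<^sub>F g in F. y (translate g A))"

definition cube_embed :: "'a filter \<Rightarrow> 'a set \<Rightarrow> bool" where
  "cube_embed F = (\<lambda>A\<in>uclopens. \<forall>\<^sub>F x in F. x \<in> A)"

lemma topspace_cube: "topspace cube = extensional uclopens"
  by (simp add: cube_def PiE_def)

lemma cube_act_extensional [simp]: "cube_act F y \<in> extensional uclopens"
  by (simp add: cube_act_def)

lemma cube_embed_extensional [simp]: "cube_embed F \<in> extensional uclopens"
  by (simp add: cube_embed_def)

text \<open>Along \<open>F\<close> the translate of \<open>A\<close> is eventually constant, so the
  condition on almost all elements is evaluation at one representative \<open>g\<close>.\<close>

lemma cube_act_eval:
  assumes "F \<in> completion_points \<U>" "eventually (indist A g) F" "A \<in> uclopens"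
  shows "cube_act F y A \<longleftrightarrow> y (translate g A)"
proof -
  have "(\<forall>\<^sub>F x in F. y (translate x A)) \<longleftrightarrow> y (translate g A)"
    using assms(2)
    by (intro eventually_constant_iff completion_pointsD(2)[OF assms(1)])
      (auto simp: indist_def elim!: eventually_mono)
  then show ?thesis using assms(3) by (simp add: cube_act_def)
qed

lemma cube_embed_eval:
  assumes "F \<in> completion_points \<U>" "eventually (indist A g) F" "A \<in> uclopens"
  shows "cube_embed F A \<longleftrightarrow> g \<in> A"
proof -
  have "(\<forall>\<^sub>F x in F. x \<in> A) \<longleftrightarrow> g \<in> A"
    using assms(2)
    by (intro eventually_constant_iff completion_pointsD(2)[OF assms(1)])
      (auto simp: indist_def elim!: eventually_mono)
  then show ?thesis using assms(3) by (simp add: cube_embed_def)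
qed

lemma cube_act_one:
  assumes "y \<in> extensional uclopens"
  shows "cube_act (nhdsin T \<one>) y = y"
proof (rule extensionalityI)
  fix A assume A: "A \<in> uclopens"
  have one: "nhdsin T \<one> \<in> completion_points \<U>"
    by (simp add: nhdsin_completion_point)
  obtain g where g: "eventually (indist A g) (nhdsin T \<one>)"
    using completion_point_coset[OF one A] by blast
  \<comment> \<open>\<open>\<one>\<close> lies in each of its neighbourhoods, so it can replace the
    chosen representative.\<close>
  then have "indist A g \<one>"
    unfolding eventually_nhdsin_one by blast
  then show "cube_act (nhdsin T \<one>) y A = y A"
    using cube_act_eval[OF one g A] translate_one[OF A] by (simp add: indist_def)
qed (use assms in auto)

text \<open>If \<open>g\<close> represents \<open>F\<close> at \<open>A\<close> and \<open>k\<close>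
  represents \<open>K\<close> at \<open>g^-1 A\<close>, then \<open>g k\<close> represents the
  product at \<open>A\<close>. Both sides reduce to \<open>y\<close> at \<open>k^-1 g^-1 A\<close>,
  or to \<open>k \<in> g^-1 A\<close> for the embedding.\<close>

lemma
  assumes F: "F \<in> completion_points \<U>" and K: "K \<in> completion_points \<U>"
  shows cube_act_mult: "cube_act (filter_mult G F K) y = cube_act F (cube_act K y)"
    and cube_embed_mult: "cube_embed (filter_mult G F K) = cube_act F (cube_embed K)"
proof -
  have "cube_act (filter_mult G F K) y A = cube_act F (cube_act K y) A \<and>
      cube_embed (filter_mult G F K) A = cube_act F (cube_embed K) A" if A: "A \<in> uclopens" for A
  proof -
    obtain g where g: "g \<in> carrier G" "eventually (indist A g) F"
      using completion_point_coset[OF F A] by blast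
    have A': "translate g A \<in> uclopens" using translate_uclopens[OF A g(1)] .
    obtain k where k: "k \<in> carrier G" "eventually (indist (translate g A) k) K"
      using completion_point_coset[OF K A'] by blast
    have gk: "eventually (indist A (g \<otimes> k)) (filter_mult G F K)"
    proof (rule eventually_filter_multI[OF g(2) k(2)])
      fix x z assume x: "indist A g x" and z: "indist (translate g A) k z"
      have "x \<otimes> z \<in> A \<longleftrightarrow> z \<in> translate x A" "g \<otimes> k \<in> A \<longleftrightarrow> k \<in> translate g A"
        using z k(1) by (simp_all add: indist_def translate_def)
      then show "indist A (g \<otimes> k) (x \<otimes> z)"
        using x z g(1) k(1) by (simp add: indist_def translate_mult)
    qed
    show ?thesis
      using g(1) k(1)
      by (simp add: cube_act_eval[OF F g(2) A] cube_act_eval[OF K k(2) A'] cube_embed_eval[OF K k(2) A']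
          cube_act_eval[OF completion_points_mult[OF F K] gk A]
          cube_embed_eval[OF completion_points_mult[OF F K] gk A] translate_mult)
        (simp add: translate_def)
  qed
  then show "cube_act (filter_mult G F K) y = cube_act F (cube_act K y)"
      "cube_embed (filter_mult G F K) = cube_act F (cube_embed K)"
    by (auto intro!: extensionalityI[of _ uclopens])
qed

text \<open>The coordinate at \<open>A\<close> is locally constant: it does not change while
  \<open>F\<close> stays among the points represented by \<open>g\<close> and \<open>y\<close> keeps
  its value at the single coordinate \<open>g^-1 A\<close>.\<close>

lemma continuous_map_cube_act:
  "continuous_map (prod_topology (completion_topology \<U>) cube) cube (\<lambda>(F, y). cube_act F y)"
  unfolding cube_def continuous_map_componentwise
proof (intro conjI ballI)
  fix A assume A: "A \<in> uclopens"
  show "continuous_map (prod_topology (completion_topology \<U>)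
      (product_topology (\<lambda>_. discrete_topology UNIV) uclopens)) (discrete_topology UNIV)
      (\<lambda>x. (case x of (F, y) \<Rightarrow> cube_act F y) A)"
    unfolding cube_def[symmetric]
  proof (rule continuous_map_discreteI, clarsimp simp: topspace_completion_topology)
    fix F y assume F: "F \<in> completion_points \<U>" and y: "y \<in> topspace cube"
    obtain g where g: "g \<in> carrier G" "eventually (indist A g) F"
      using completion_point_coset[OF F A] by blast
    let ?V = "{z \<in> topspace cube. z (translate g A) \<in> {y (translate g A)}}"
    have "openin cube ?V"
      unfolding cube_def
      by (rule openin_continuous_map_preimage[OF continuous_map_product_projection])
        (use translate_uclopens[OF A g(1)] in auto)
    then have "openin (prod_topology (completion_topology \<U>) cube)
        ({K \<in> completion_points \<U>. eventually (indist A g) K} \<times> ?V)"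
      by (simp add: openin_prod_Times_iff openin_completion_basic)
    then show "\<exists>U. openin (prod_topology (completion_topology \<U>) cube) U \<and> (F, y) \<in> U \<and>
        (\<forall>z\<in>U. (case z of (F, y) \<Rightarrow> cube_act F y) A = cube_act F y A)"
      using F y g(2) by (intro exI conjI) (auto simp: cube_act_eval[OF _ _ A])
  qed
qed auto

lemma continuous_map_cube_embed: "continuous_map (completion_topology \<U>) cube cube_embed"
  unfolding cube_def continuous_map_componentwise
proof (intro conjI ballI)
  fix A assume A: "A \<in> uclopens"
  show "continuous_map (completion_topology \<U>) (discrete_topology UNIV) (\<lambda>F. cube_embed F A)"
  proof (rule continuous_map_discreteI, unfold topspace_completion_topology)
    fix F assume F: "F \<in> completion_points \<U>"
    obtain g where g: "eventually (indist A g) F"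
      using completion_point_coset[OF F A] by blast
    then show "\<exists>U. openin (completion_topology \<U>) U \<and> F \<in> U \<and> (\<forall>K\<in>U. cube_embed K A = cube_embed F A)"
      using F g
      by (intro exI[of _ "{K \<in> completion_points \<U>. eventually (indist A g) K}"])
        (auto simp: openin_completion_basic cube_embed_eval[OF _ _ A])
  qed
qed auto

text \<open>Here the non-archimedean hypothesis enters. Roundness places \<open>U B\<close> inside
  \<open>M\<close>, and an open subgroup \<open>H \<subseteq> U\<close> makes \<open>H B\<close> an
  invariant set between \<open>B\<close> and \<open>M\<close>.\<close>

lemma cube_embed_nbhd:
  assumes NA: "NA_group G T" and W: "openin (completion_topology \<U>) W" "F \<in> W"
  obtains A where "A \<in> uclopens" "cube_embed F A" "\<And>K. K \<in> completion_points \<U> \<Longrightarrow> cube_embed K A \<Longrightarrow> K \<in> W"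
proof -
  obtain M where M: "eventually M F" "\<And>K. \<lbrakk>K \<in> completion_points \<U>; eventually M K\<rbrakk> \<Longrightarrow> K \<in> W"
      and F: "F \<in> completion_points \<U>"
    using W unfolding openin_completion_topology by blast
  obtain U B where U: "nbhd1 U" and B: "eventually B F" and UB: "\<And>x y. x \<in> U \<Longrightarrow> B y \<Longrightarrow> M (x \<otimes> y)"
    using completion_point_round[OF F M(1)] by blast
  obtain H where H: "subgroup H G" "openin T H" "H \<subseteq> U"
    using NA U unfolding NA_group_def by meson
  define A where "A = {x \<in> carrier G. \<exists>h\<in>H. \<exists>b\<in>carrier G. B b \<and> x = h \<otimes> b}"
  have "k \<otimes> x \<in> A" if "k \<in> H" "x \<in> A" for k x
  proof -
    obtain h b where hb: "h \<in> H" "b \<in> carrier G" "B b" "x = h \<otimes> b"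
      using \<open>x \<in> A\<close> by (auto simp: A_def)
    then have "k \<otimes> x = (k \<otimes> h) \<otimes> b" "k \<otimes> h \<in> H"
      using \<open>k \<in> H\<close> H(1) by (auto simp: m_assoc subgroup.mem_carrier subgroup.m_closed)
    then show ?thesis
      using hb subgroup.mem_carrier[OF H(1)] by (auto simp: A_def)
  qed
  moreover have "A \<subseteq> carrier G" by (auto simp: A_def)
  ultimately have A: "A \<in> uclopens"
    using H(1,2) unfolding uclopens_def by blast
  have "\<forall>\<^sub>F x in F. x \<in> A"
    using B completion_pointsD(3)[OF F]
  proof eventually_elim
    fix x assume "B x" "x \<in> carrier G"
    then show "x \<in> A"
      using subgroup.one_closed[OF H(1)] l_one[of x, symmetric] unfolding A_def by blast
  qed
  moreover have "M x" if "x \<in> A" for x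
    using that UB H(3) by (auto simp: A_def)
  ultimately show ?thesis
    using A M(2) by (intro that[of A]) (simp_all add: cube_embed_def eventually_mono[of "\<lambda>x. x \<in> A"])
qed

lemma embedding_map_cube_embed:
  assumes "NA_group G T"
  shows "embedding_map (completion_topology \<U>) cube cube_embed"
proof (rule embedding_mapI[OF continuous_map_cube_embed])
  show "inj_on cube_embed (topspace (completion_topology \<U>))"
  proof (rule inj_onI, rule ccontr)
    fix F K assume FK: "F \<in> topspace (completion_topology \<U>)" "K \<in> topspace (completion_topology \<U>)"
      "cube_embed F = cube_embed K" "F \<noteq> K"
    then obtain V W where "openin (completion_topology \<U>) V" "F \<in> V" "K \<notin> V"
      using Hausdorff_completion unfolding Hausdorff_space_def disjnt_iff by metis
    then show False
      using cube_embed_nbhd[OF assms, of V F] FK by (metis topspace_completion_topology)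
  qed
next
  fix W F assume "openin (completion_topology \<U>) W" "F \<in> W"
  then obtain A where A: "A \<in> uclopens" "cube_embed F A" "\<And>K. K \<in> completion_points \<U> \<Longrightarrow> cube_embed K A \<Longrightarrow> K \<in> W"
    using cube_embed_nbhd[OF assms] by blast
  \<comment> \<open>The cylinder over the single coordinate \<open>A\<close> is the open set whose
    preimage lies in \<open>W\<close>.\<close>
  have "openin cube {z \<in> topspace cube. z A \<in> {True}}"
    unfolding cube_def
    by (rule openin_continuous_map_preimage[OF continuous_map_product_projection]) (use A in auto)
  then show "\<exists>V. openin cube V \<and> cube_embed F \<in> V \<and>
      (\<forall>z\<in>topspace (completion_topology \<U>). cube_embed z \<in> V \<longrightarrow> z \<in> W)"
    using A by (intro exI conjI) (auto simp: topspace_completion_topology topspace_cube)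
qed

lemma NA_imp_l_NA_monoid:
  assumes NA: "NA_group G T"
  shows "l_NA_monoid S (completion_topology \<U>)"
proof (rule l_NA_monoidI)
  have Stone: "Stone_space cube"
    unfolding cube_def by (rule Stone_space_Cantor_cube)
  \<comment> \<open>Complete regularity is inherited from the compact cube through the
    embedding.\<close>
  show "topological_monoid S (completion_topology \<U>)"
    using completely_regular_space_embedding[OF embedding_map_cube_embed[OF NA]
        Stone_imp_completely_regular_space[OF Stone]]
    by (simp add: topological_monoid_def monoid_completion topspace_completion_topology
        Hausdorff_completion continuous_map_completion_mult)
  define C where "C = cube closure_of (cube_embed ` completion_points \<U>)"
  define Y where "Y = subtopology cube C"
  have Y: "topspace Y = C" "C \<subseteq> extensional uclopens"
    using closure_of_subset_topspace[of cube] by (auto simp: Y_def C_def topspace_cube)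
  have embed_C: "cube_embed ` completion_points \<U> \<subseteq> C"
    unfolding C_def by (rule closure_of_subset) (auto simp: topspace_cube)
  \<comment> \<open>The map sending \<open>y\<close> to \<open>F y\<close> is continuous and, by
    equivariance, preserves the image of the completion; hence it preserves the closure of that
    image.\<close>
  have act_C: "cube_act F y \<in> C" if F: "F \<in> completion_points \<U>" and y: "y \<in> C" for F y
  proof -
    have "continuous_map cube (prod_topology (completion_topology \<U>) cube) (\<lambda>y. (F, y))"
      using F by (simp add: continuous_map_pairedI topspace_completion_topology)
    from continuous_map_compose[OF this continuous_map_cube_act]
    have "continuous_map cube cube (cube_act F)" by (simp add: o_def)
    then have "cube_act F y \<in> cube closure_of (cube_act F ` cube_embed ` completion_points \<U>)"
      using continuous_map_image_closure_subset y unfolding C_def by fastforce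
    moreover have "cube_act F ` cube_embed ` completion_points \<U> \<subseteq> cube_embed ` completion_points \<U>"
      using F by (auto simp: cube_embed_mult[symmetric] completion_points_mult)
    ultimately show ?thesis
      unfolding C_def using closure_of_mono by blast
  qed
  show "l_NA_witness S (completion_topology \<U>) Y cube_act cube_embed"
    unfolding l_NA_witness_def
  proof (intro conjI ballI)
    show "Stone_space Y"
      unfolding Y_def C_def by (rule Stone_space_closed_subtopology[OF Stone]) simp
    show "continuous_map (prod_topology (completion_topology \<U>) Y) Y (\<lambda>(F, y). cube_act F y)"
      unfolding Y_def
      by (rule continuous_map_into_subtopology)
        (use act_C in \<open>auto simp: prod_topology_subtopology topspace_completion_topology
          continuous_map_from_subtopology continuous_map_cube_act\<close>)
    show "embedding_map (completion_topology \<U>) Y cube_embed"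
      unfolding Y_def embedding_map_in_subtopology
      using embedding_map_cube_embed[OF NA] embed_C by (simp add: topspace_completion_topology)
    show "Y closure_of (cube_embed ` carrier S) = topspace Y"
      using embed_C unfolding Y(1)
      by (simp add: Y_def closure_of_subtopology Int_absorb1 flip: C_def)
  qed (use Y in \<open>auto simp: mult_completion cube_act_one cube_act_mult cube_embed_mult\<close>)
qed

section \<open>Open subgroups from actions on Stone spaces\<close>

text \<open>The setwise stabilizer of a clopen set is open by compactness of \<open>Y\<close>, and those of the clopen
  neighbourhoods of \<open>y\<^sub>0\<close> form a local base at the identity.\<close>

lemma NA_groupI_Stone_action:
  assumes Y: "Stone_space Y"
    and cont: "continuous_map (prod_topology T Y) Y (\<lambda>(g, y). a g y)"
    and one: "\<And>y. y \<in> topspace Y \<Longrightarrow> a \<one> y = y"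
    and mult: "\<And>g h y. \<lbrakk>g \<in> carrier G; h \<in> carrier G; y \<in> topspace Y\<rbrakk> \<Longrightarrow> a (g \<otimes> h) y = a g (a h y)"
    and y0: "y\<^sub>0 \<in> topspace Y"
    and nbhd: "\<And>W. nbhd1 W \<Longrightarrow> \<exists>V. openin Y V \<and> y\<^sub>0 \<in> V \<and> (\<forall>g\<in>carrier G. a g y\<^sub>0 \<in> V \<longrightarrow> g \<in> W)"
  shows "NA_group G T"
proof -
  have aY: "a g y \<in> topspace Y" if "g \<in> carrier G" "y \<in> topspace Y" for g y
    using funcset_mem[OF continuous_map_funspace[OF cont], of "(g, y)"] that by simp
  have open_stab: "openin T {g \<in> carrier G. \<forall>y\<in>C. a g y \<in> C}" if C: "openin Y C" "closedin Y C" for C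
  proof (subst openin_subopen, clarsimp)
    fix g assume g: "g \<in> carrier G" "\<forall>y\<in>C. a g y \<in> C"
    let ?W = "{p \<in> topspace (prod_topology T Y). (case p of (g, y) \<Rightarrow> a g y) \<in> C}"
    have "openin (prod_topology T Y) ?W"
      using openin_continuous_map_preimage[OF cont C(1)] .
    moreover have "compactin Y C"
      using Y C(2) closedin_compact_space unfolding Stone_space_def by blast
    moreover have "{g} \<times> C \<subseteq> ?W"
      using g openin_subset[OF C(1)] by auto
    \<comment> \<open>The tube lemma supplies one neighbourhood of \<open>g\<close> whose elements
      all map the compact set \<open>C\<close> into itself.\<close>
    ultimately obtain U V where UV: "openin T U" "g \<in> U" "C \<subseteq> V" "U \<times> V \<subseteq> ?W"
      using tube_lemma_right[of T Y ?W C g] g(1) by auto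
    then have "x \<in> carrier G \<and> (\<forall>y\<in>C. a x y \<in> C)" if "x \<in> U" for x
      using that subsetD[OF UV(3)] subsetD[OF UV(4), of "(x, _)"] open_subset_carrier[OF UV(1), of x]
      by auto
    then show "\<exists>U. openin T U \<and> g \<in> U \<and> U \<subseteq> {g \<in> carrier G. \<forall>y\<in>C. a g y \<in> C}"
      using UV by (intro exI[of _ U]) auto
  qed
  \<comment> \<open>The equivalence makes the stabilizer closed under inverses, which mapping
    \<open>C\<close> into itself alone would not give.\<close>
  define stab where "stab C = {g \<in> carrier G. \<forall>y\<in>topspace Y. a g y \<in> C \<longleftrightarrow> y \<in> C}" for C
  have stab_subgroup: "subgroup (stab C) G" for C
  proof (rule subgroupI)
    show "stab C \<noteq> {}" using one by (auto simp: stab_def)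
  next
    fix g assume g: "g \<in> stab C"
    then have gG: "g \<in> carrier G" by (simp add: stab_def)
    have "a (inv g) y \<in> C \<longleftrightarrow> y \<in> C" if y: "y \<in> topspace Y" for y
    proof -
      have "a g (a (inv g) y) = y"
        using mult[of g "inv g" y] one[OF y] gG y by simp
      moreover have "a g (a (inv g) y) \<in> C \<longleftrightarrow> a (inv g) y \<in> C"
        using g aY[OF inv_closed[OF gG] y] unfolding stab_def by blast
      ultimately show ?thesis by simp
    qed
    then show "inv g \<in> stab C" using gG by (simp add: stab_def)
  next
    fix g h assume "g \<in> stab C" "h \<in> stab C"
    then show "g \<otimes> h \<in> stab C" by (auto simp: stab_def mult aY)
  qed (auto simp: stab_def)
  have stab_open: "openin T (stab C)" if C: "openin Y C" "closedin Y C" for C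
  proof -
    \<comment> \<open>The equivalence splits into an inclusion for \<open>C\<close> and one for its
      complement, which is again clopen.\<close>
    have "stab C = {g \<in> carrier G. \<forall>y\<in>C. a g y \<in> C} \<inter>
        {g \<in> carrier G. \<forall>y\<in>topspace Y - C. a g y \<in> topspace Y - C}"
      using openin_subset[OF C(1)] aY by (auto simp: stab_def)
    moreover have "openin Y (topspace Y - C)" "closedin Y (topspace Y - C)"
      using C by (auto simp: openin_diff closedin_diff)
    ultimately show ?thesis
      using open_stab[OF C] open_stab[of "topspace Y - C"] by auto
  qed
  obtain \<B> where \<B>: "\<forall>C\<in>\<B>. openin Y C \<and> closedin Y C"
      "\<forall>U y. openin Y U \<and> y \<in> U \<longrightarrow> (\<exists>C\<in>\<B>. y \<in> C \<and> C \<subseteq> U)"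
    using Y unfolding Stone_space_def by blast
  have "\<exists>H\<in>stab ` \<B>. H \<subseteq> W" if W: "nbhd1 W" for W
  proof -
    obtain V where V: "openin Y V" "y\<^sub>0 \<in> V" "\<And>g. g \<in> carrier G \<Longrightarrow> a g y\<^sub>0 \<in> V \<Longrightarrow> g \<in> W"
      using nbhd[OF W] by blast
    then obtain C where "C \<in> \<B>" "y\<^sub>0 \<in> C" "C \<subseteq> V" using \<B>(2) by blast
    \<comment> \<open>An element stabilizing \<open>C\<close> sends \<open>y\<^sub>0\<close> into
      \<open>C \<subseteq> V\<close>, hence lies in \<open>W\<close>.\<close>
    then show ?thesis using V(3) y0 by (intro bexI[of _ "stab C"]) (auto simp: stab_def)
  qed
  moreover have "\<forall>H\<in>stab ` \<B>. subgroup H G \<and> openin T H"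
    using stab_subgroup stab_open \<B>(1) by auto
  ultimately show ?thesis
    unfolding NA_group_def using top_group by blast
qed

text \<open>\<open>G\<close> acts through its neighbourhood filters, and equivariance identifies the
  orbit of \<open>\<nu> (nhdsin T \<one>)\<close> with the image of \<open>G\<close>. As
  \<open>\<nu>\<close> is an embedding, open sets of \<open>Y\<close> around that point cut out
  arbitrarily small neighbourhoods of \<open>\<one>\<close>.\<close>

lemma l_NA_monoid_imp_NA:
  assumes "l_NA_monoid S (completion_topology \<U>)"
  shows "NA_group G T"
proof -
  obtain Y :: "'a filter set set topology" and act \<nu> where
    w: "l_NA_witness S (completion_topology \<U>) Y act \<nu>"
    using assms unfolding l_NA_monoid_def by blast
  let ?\<iota> = "nhdsin T"
  have cont: "continuous_map (prod_topology (completion_topology \<U>) Y) Y (\<lambda>(s, y). act s y)"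
    and one: "\<And>y. y \<in> topspace Y \<Longrightarrow> act (?\<iota> \<one>) y = y"
    and mult: "\<And>s t y. \<lbrakk>s \<in> completion_points \<U>; t \<in> completion_points \<U>; y \<in> topspace Y\<rbrakk> \<Longrightarrow>
        act (s \<otimes>\<^bsub>S\<^esub> t) y = act s (act t y)"
    and emb: "embedding_map (completion_topology \<U>) Y \<nu>"
    and equiv: "\<And>s t. \<lbrakk>s \<in> completion_points \<U>; t \<in> completion_points \<U>\<rbrakk> \<Longrightarrow>
        \<nu> (s \<otimes>\<^bsub>S\<^esub> t) = act s (\<nu> t)"
    using w unfolding l_NA_witness_def by auto
  have \<iota>: "?\<iota> g \<in> completion_points \<U>" if "g \<in> carrier G" for g
    using nhdsin_completion_point[OF that] .
  have orbit: "act (?\<iota> g) (\<nu> (?\<iota> \<one>)) = \<nu> (?\<iota> g)" if "g \<in> carrier G" for g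
    using equiv[OF \<iota>[OF that] \<iota>[OF one_closed]] that by (simp add: mult_completion \<iota> filter_mult_nhdsin)
  show ?thesis
  proof (rule NA_groupI_Stone_action)
    show "Stone_space Y" using w by (simp add: l_NA_witness_def)
    have "continuous_map (prod_topology T Y) (prod_topology (completion_topology \<U>) Y) (\<lambda>(g, y). (?\<iota> g, y))"
      using continuous_map_pairedI[OF
          continuous_map_compose[OF continuous_map_fst continuous_map_nhdsin] continuous_map_snd]
      by (simp add: case_prod_unfold)
    from continuous_map_compose[OF this cont]
    show "continuous_map (prod_topology T Y) Y (\<lambda>(g, y). act (?\<iota> g) y)"
      by (simp add: o_def case_prod_unfold)
    show "act (?\<iota> (g \<otimes> h)) y = act (?\<iota> g) (act (?\<iota> h) y)"
      if "g \<in> carrier G" "h \<in> carrier G" "y \<in> topspace Y" for g h y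
      using mult[OF \<iota>[OF that(1)] \<iota>[OF that(2)] that(3)] that
      by (simp add: mult_completion \<iota> filter_mult_nhdsin)
    show "\<nu> (?\<iota> \<one>) \<in> topspace Y"
      using embedding_map_image_subset[OF emb, of "{?\<iota> \<one>}"] \<iota> by (simp add: topspace_completion_topology)
    fix W assume W: "nbhd1 W"
    \<comment> \<open>The basic open set of points containing \<open>W\<close>. Every neighbourhood
      of \<open>g\<close> contains \<open>g\<close>, so a neighbourhood filter in \<open>?W\<close>
      has its centre in \<open>W\<close>.\<close>
    let ?W = "{F \<in> completion_points \<U>. \<forall>\<^sub>F x in F. x \<in> W}"
    obtain V where V: "openin Y V"
        "\<And>F. F \<in> topspace (completion_topology \<U>) \<Longrightarrow> \<nu> F \<in> V \<longleftrightarrow> F \<in> ?W"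
      using embedding_map_open_preimage[OF emb openin_completion_basic] by blast
    have "g \<in> W" if "g \<in> carrier G" "\<forall>\<^sub>F x in ?\<iota> g. x \<in> W" for g
      using that by (auto simp: eventually_nhdsin)
    moreover have "\<forall>\<^sub>F x in ?\<iota> \<one>. x \<in> W"
      using W unfolding eventually_nhdsin_one by blast
    ultimately show "\<exists>V. openin Y V \<and> \<nu> (?\<iota> \<one>) \<in> V \<and>
        (\<forall>g\<in>carrier G. act (?\<iota> g) (\<nu> (?\<iota> \<one>)) \<in> V \<longrightarrow> g \<in> W)"
      using V \<iota> by (intro exI[of _ V]) (auto simp: orbit topspace_completion_topology)
  qed (use one in auto)
qed

lemma NA_iff_l_NA_monoid: "NA_group G T \<longleftrightarrow> l_NA_monoid S (completion_topology \<U>)"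
  using NA_imp_l_NA_monoid l_NA_monoid_imp_NA by blast

end

section \<open>Duality\<close>

text \<open>The result is a bare monoid record, so taking the opposite twice recovers only
  structures without further fields.\<close>

definition opposite :: "('a, 'b) monoid_scheme \<Rightarrow> 'a monoid" where
  "opposite G = \<lparr>carrier = carrier G, monoid.mult = (\<lambda>x y. y \<otimes>\<^bsub>G\<^esub> x), one = \<one>\<^bsub>G\<^esub>\<rparr>"

lemma opposite_simps [simp]:
  "carrier (opposite G) = carrier G" "x \<otimes>\<^bsub>opposite G\<^esub> y = y \<otimes>\<^bsub>G\<^esub> x" "\<one>\<^bsub>opposite G\<^esub> = \<one>\<^bsub>G\<^esub>"
  by (simp_all add: opposite_def)

lemma inv_opposite [simp]: "inv\<^bsub>opposite G\<^esub> x = inv\<^bsub>G\<^esub> x"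
  by (simp add: m_inv_def conj_commute)

lemma opposite_opposite: "opposite (opposite G) = (G :: 'a monoid)"
  by (simp add: opposite_def)

lemma monoid_opposite: "monoid G \<Longrightarrow> monoid (opposite G)"
  by (rule monoidI) (auto simp: monoid.m_assoc monoid.m_closed)

lemma group_opposite:
  assumes "group G"
  shows "group (opposite G)"
proof -
  interpret group G by fact
  show ?thesis
    by (rule groupI) (auto simp: m_assoc intro: r_inv inv_closed)
qed

lemma continuous_map_swap_iff:
  "continuous_map (prod_topology X Y) Z (\<lambda>(x, y). f x y) \<longleftrightarrow>
     continuous_map (prod_topology Y X) Z (\<lambda>(y, x). f x y)"
proof -
  have *: "continuous_map (prod_topology Y X) Z (\<lambda>(y, x). f x y)"
    if "continuous_map (prod_topology X Y) Z (\<lambda>(x, y). f x y)" for f and X :: "'x topology" and Y :: "'y topology"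
    using continuous_map_compose[OF continuous_map_pairedI[OF continuous_map_snd continuous_map_fst] that]
    by (simp add: o_def case_prod_unfold)
  show ?thesis using *[of X Y f] *[of Y X "\<lambda>y x. f x y"] by blast
qed

lemma topological_group_opposite:
  assumes "topological_group G T"
  shows "topological_group (opposite G) T"
  using assms continuous_map_swap_iff[of T T T "\<lambda>x y. x \<otimes>\<^bsub>G\<^esub> y"]
  by (auto simp: topological_group_def group_opposite)

lemma topological_monoid_opposite:
  assumes "topological_monoid S T"
  shows "topological_monoid (opposite S) T"
  using assms continuous_map_swap_iff[of T T T "\<lambda>x y. x \<otimes>\<^bsub>S\<^esub> y"]
  by (auto simp: topological_monoid_def monoid_opposite)

lemma subgroup_opposite_iff: "subgroup H (opposite G) \<longleftrightarrow> subgroup H G"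
  by (auto simp: subgroup_def)

lemma NA_group_opposite_iff:
  assumes "topological_group G T"
  shows "NA_group (opposite G) T \<longleftrightarrow> NA_group G T"
  using assms topological_group_opposite[OF assms]
  by (simp add: NA_group_def subgroup_opposite_iff)

text \<open>Exchanging the arguments turns a right action into a left action of the opposite monoid;
  the space and the embedding stay the same.\<close>

lemma r_NA_monoid_iff_opposite:
  fixes S :: "'s monoid"
  shows "r_NA_monoid S T \<longleftrightarrow> l_NA_monoid (opposite S) T"
proof -
  have w: "r_NA_witness S T Y act \<nu> \<longleftrightarrow> l_NA_witness (opposite S) T Y (\<lambda>s y. act y s) \<nu>"
    for Y :: "'s set set topology" and act \<nu>
    using continuous_map_swap_iff[of Y T Y act]
    by (auto simp: r_NA_witness_def l_NA_witness_def)
  have "(\<exists>(Y :: 's set set topology) act \<nu>. r_NA_witness S T Y act \<nu>) \<longleftrightarrow>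
      (\<exists>(Y :: 's set set topology) act \<nu>. l_NA_witness (opposite S) T Y act \<nu>)" (is "?L \<longleftrightarrow> ?R")
  proof
    assume ?R
    then obtain Y :: "'s set set topology" and act \<nu> where
      "l_NA_witness (opposite S) T Y act \<nu>" by blast
    then have "r_NA_witness S T Y (\<lambda>y s. act s y) \<nu>" by (simp add: w)
    then show ?L by blast
  qed (use w in blast)
  moreover have "topological_monoid S T \<longleftrightarrow> topological_monoid (opposite S) T"
    using topological_monoid_opposite[of S T] topological_monoid_opposite[of "opposite S" T]
    by (auto simp: opposite_opposite)
  ultimately show ?thesis
    unfolding r_NA_monoid_def l_NA_monoid_def by simp
qed

text \<open>In the opposite group \<open>x y^-1\<close> becomes \<open>y^-1 x = (x^-1 y)^-1\<close>,
  and inversion permutes the open neighbourhoods of the identity.\<close>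

lemma (in top_group) left_uniformity_eq_opposite:
  "left_uniformity G T = right_uniformity (opposite G) T"
proof -
  have nbhd_inv: "nbhd1 {z \<in> carrier G. inv z \<in> U}" if "nbhd1 U" for U
    using openin_continuous_map_preimage[OF continuous_map_group_inv[OF continuous_map_id] conjunct1[OF that]]
      that by simp
  let ?L = "\<lambda>U. {(x, y). x \<in> carrier G \<and> y \<in> carrier G \<and> inv x \<otimes> y \<in> U}"
  let ?R = "\<lambda>U. {(x, y). x \<in> carrier G \<and> y \<in> carrier G \<and> inv y \<otimes> x \<in> U}"
  have LR: "?L {z \<in> carrier G. inv z \<in> U} = ?R U" "?R {z \<in> carrier G. inv z \<in> U} = ?L U" for U
    by (auto simp: inv_mult_group)
  have "left_uniformity G T = (INF U\<in>Collect nbhd1. principal (?L U))"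
    by (simp add: left_uniformity_def)
  also have "\<dots> = (INF U\<in>Collect nbhd1. principal (?R U))"
  proof (rule INF_eq)
    fix U assume "U \<in> Collect nbhd1"
    then have V: "{z \<in> carrier G. inv z \<in> U} \<in> Collect nbhd1" using nbhd_inv by blast
    show "\<exists>V\<in>Collect nbhd1. principal (?L V) \<le> principal (?R U)"
      by (rule bexI[OF _ V], unfold LR, rule order_refl)
    show "\<exists>V\<in>Collect nbhd1. principal (?R V) \<le> principal (?L U)"
      by (rule bexI[OF _ V], unfold LR, rule order_refl)
  qed
  also have "\<dots> = right_uniformity (opposite G) T"
    by (simp add: right_uniformity_def)
  finally show ?thesis .
qed

text \<open>Both sides use the same completion, and exchanging arguments is a bijection between the
  extensions of the two multiplications. Existence and uniqueness thus transfer from the opposite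
  group, for which \<open>\<V>\<close> is the right uniformity.\<close>

lemma completion_mult_opposite:
  fixes G :: "('a, 'b) monoid_scheme"
  assumes "topological_group (opposite G) T"
  defines "\<V> \<equiv> right_uniformity (opposite G) T"
  shows "completion_mult G T \<V> = completion_mult (opposite G) T \<V> \<circ> prod.swap"
proof -
  interpret op: top_group "opposite G" T
    using assms(1) by unfold_locales
  have swap: "extends_mult G T \<V> m \<longleftrightarrow> extends_mult (opposite G) T \<V> (m \<circ> prod.swap)" for m
    using continuous_map_swap_iff[of "completion_topology \<V>" "completion_topology \<V>"
        "completion_topology \<V>" "\<lambda>F H. m (F, H)"]
    by (auto simp: extends_mult_def extensional_def o_def case_prod_unfold prod.swap_def)
  show ?thesis
  proof (rule completion_mult_eqI)
    show "extends_mult G T \<V> (completion_mult (opposite G) T \<V> \<circ> prod.swap)"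
      using op.extends_mult_completion_times
      unfolding swap op.completion_mult_eq[folded \<V>_def] comp_assoc swap_comp_swap
      by (simp add: \<V>_def)
    fix m assume "extends_mult G T \<V> m"
    then have "m \<circ> prod.swap = completion_mult (opposite G) T \<V>"
      using op.extends_mult_unique unfolding swap op.completion_mult_eq[folded \<V>_def]
      by (simp add: \<V>_def)
    then show "m = completion_mult (opposite G) T \<V> \<circ> prod.swap"
      by (metis comp_assoc comp_id swap_comp_swap)
  qed
qed

lemma completion_monoid_opposite:
  assumes "topological_group (opposite G) T"
  defines "\<V> \<equiv> right_uniformity (opposite G) T"
  shows "opposite (completion_monoid G T \<V>) = completion_monoid (opposite G) T \<V>"
  using completion_mult_opposite[OF assms(1)]
  by (simp add: completion_monoid_def opposite_def \<V>_def)

theorem proposition4p13: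
  fixes G :: "('a, 'b) monoid_scheme" and T :: "'a topology"
  assumes "topological_group G T"
  shows "(NA_group G T \<longleftrightarrow>
            l_NA_monoid (completion_monoid G T (right_uniformity G T))
                        (completion_topology (right_uniformity G T))) \<and>
         (NA_group G T \<longleftrightarrow>
            r_NA_monoid (completion_monoid G T (left_uniformity G T))
                        (completion_topology (left_uniformity G T)))"
proof -
  interpret top_group G T using assms by unfold_locales
  have op: "topological_group (opposite G) T"
    using topological_group_opposite[OF assms] .
  then interpret op: top_group "opposite G" T by unfold_locales
  \<comment> \<open>The second equivalence is the first one for the opposite group, read back
    through the duality lemmas.\<close>
  show ?thesis
    using NA_iff_l_NA_monoid op.NA_iff_l_NA_monoid NA_group_opposite_iff[OF assms]
    by (simp add: r_NA_monoid_iff_opposite left_uniformity_eq_opposite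
        completion_monoid_opposite[OF op])
qed

end
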